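(* Let $p(x,y)=xy-\sum_{s=0}^4 q_sx^s$ with $q_i\in\mathbb R$, $q_0\ne0$, $q_4=1$, and let $\mathcal Z(p)=\{(x,y)\in\mathbb R^2:p(x,y)=0\}$. Let $n\ge4$ and let $\beta=(\beta_{i,j})_{i,j\in\mathbb Z_+,\ i+j\le 2n}$ be a $p$-pure real sequence with $\beta_{0,0}>0$. With the notation of the context, assume that $A_{\widetilde\gamma}$ is positive definite. Suppose that there exists a triple $(t_1,t_2,t_3)\in\mathbb R^3$ such that: (1) the quadratic polynomial $d(\mathbf t_1)=\det F_1(\mathbf t_1)$ has a real zero; let $(t_1)_-\le (t_1)_+$ denote its real zeros; (2) $t_1\in((t_1)_-,(t_1)_+)$; (3) $\displaystyle t_3>v^T\Big(A_{\widetilde\gamma}^{-1}+\frac1{w_1}A_{\widetilde\gamma}^{-1}c_1c_1^TA_{\widetilde\gamma}^{-1}\Big)v-\frac{2t_2}{w_1}v^TA_{\widetilde\gamma}^{-1}c_1+\frac{t_2^2}{w_1}$; (4) $\displaystyle \gamma_{-2n}(t_1,t_2,t_3)>z_2^T\Big(B^{-1}+\frac1{w_2}B^{-1}c_2c_2^TB^{-1}\Big)z_2-\frac{2\gamma_{2n}}{w_2}z_2^TB^{-1}c_2+\frac{\gamma_{2n}^2}{w_2}$. Then $\beta$ admits a $\mathcal Z(p)$-representing measure.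
   Context: A $\mathcal Z(p)$-representing measure for $\beta$ is a positive Borel measure $\mu$ on $\mathbb R^2$ with $\operatorname{supp}\mu\subseteq\mathcal Z(p)$ and $\beta_{i,j}=\int x^iy^j\,d\mu$ for all $i,j\in\mathbb Z_+$, $i+j\le 2n$. The moment matrix is $M(n)=(\beta_{\mathbf i+\mathbf j})_{\mathbf i,\mathbf j\in\mathbb Z_+^2,\ |\mathbf i|,|\mathbf j|\le n}$, with columns labelled by the monomials $X^iY^j$, $i+j\le n$. For $g=\sum a_{ij}x^iy^j$ of degree at most $n$, $g(X,Y)=\sum a_{ij}X^iY^j$ denotes the corresponding linear combination of columns; $g(X,Y)=\mathbf 0$ is a column relation. The sequence $\beta$ is $p$-pure if the only column relations of $M(n)$ are those recursively derived from $p$: for $g$ of degree at most $n$, $g(X,Y)=\mathbf 0$ if and only if $g=p\,q$ for some $q\in\mathbb R[x,y]$ with $\deg(pq)\le n$. Coefficients: for $j\ge0$ the numbers $q_{j,t}$, $-j\le t\le 3j$, are defined by $\big(\sum_{s=0}^4q_sx^{s-1}\big)^j=\sum_{t=-j}^{3j}q_{j,t}x^t$. Construction of $\gamma=(\gamma_{-2n},\dots,\gamma_{6n})$: let $\gamma_{6n-3}=t_1$, $\gamma_{6n-1}=t_2$, $\gamma_{6n}=t_3$ be free real parameters. Set $\gamma_i=\beta_{i,0}$ for $0\le i\le2n$. For $k=1,\dots,2n-2$ successively set $$\gamma_{-k}=\frac1{q_0^k}\Big(\beta_{0,k}-\sum_{t=-k+1}^{3k}q_{k,t}\gamma_t\Big),$$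 $$\gamma_{2n+2k-1}=\beta_{2n-k-1,k}-\sum_{t=-k}^{3k-1}q_{k,t}\gamma_{t+2n-k-1},\qquad \gamma_{2n+2k}=\beta_{2n-k,k}-\sum_{t=-k}^{3k-1}q_{k,t}\gamma_{t+2n-k}.$$ Then set $$\gamma_{-2n+1}=\gamma_{-2n+1}(t_1)=\frac1{q_0^{2n-1}}\Big(\beta_{0,2n-1}-\sum_{t=-2n+2}^{6n-3}q_{2n-1,t}\gamma_t\Big),$$ $$\gamma_{6n-2}=\gamma_{6n-2}(t_1)=\beta_{1,2n-1}-\sum_{t=-2n+1}^{6n-4}q_{2n-1,t}\gamma_{t+1},$$ $$\gamma_{-2n}=\gamma_{-2n}(t_1,t_2,t_3)=\frac1{q_0^{2n}}\Big(\beta_{0,2n}-\sum_{t=-2n+1}^{6n}q_{2n,t}\gamma_t\Big).$$ All $\gamma_s$ with $-2n+2\le s\le 6n-4$ are determined by $\beta$ alone. Further notation: $\widetilde\gamma=(\gamma_{-2n+2},\gamma_{-2n+3},\dots,\gamma_{6n-4})$ and $A_{\widetilde\gamma}=(\gamma_{-2n+2+i+j})_{i,j=0}^{4n-3}$; $F_1(t_1)=(\gamma_{-2n+2+i+j})_{i,j=0}^{4n-2}$ (its entries involve $t_1$ and $\gamma_{6n-2}(t_1)$), so that $d(\mathbf t_1)=\det F_1(\mathbf t_1)$ is a quadratic polynomial in $\mathbf t_1$; $c_1=(\gamma_{2n},\gamma_{2n+1},\dots,\gamma_{6n-4},t_1)^T$; $w_1=\gamma_{6n-2}(t_1)-c_1^TA_{\widetilde\gamma}^{-1}c_1$;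 $v=(\gamma_{2n+1},\gamma_{2n+2},\dots,\gamma_{6n-4},t_1,\gamma_{6n-2}(t_1))^T$; $B=F_1(t_1)$; $c_2=(\gamma_{2n+1},\dots,\gamma_{6n-4},t_1,\gamma_{6n-2}(t_1),t_2)^T$; $w_2=t_3-c_2^TB^{-1}c_2$; $z_2=(\gamma_{-2n+1}(t_1),\gamma_{-2n+2},\dots,\gamma_{2n-1})^T$. *)

theory Defs
  imports
    "HOL-Analysis.Analysis"
    "HOL-Computational_Algebra.Formal_Laurent_Series"
    "Jordan_Normal_Form.Determinant"
    "Jordan_Normal_Form.Gauss_Jordan_Elimination"
begin

text \<open>
  Elements of R[x,y] are represented as polynomials in y over R[x]: the coefficient of
  x^i y^j in \<open>g\<close> is \<open>coeff (coeff g j) i\<close>.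
\<close>

definition coeff2 :: "real poly poly \<Rightarrow> nat \<Rightarrow> nat \<Rightarrow> real" where
  "coeff2 g i j = Polynomial.coeff (Polynomial.coeff g j) i"

definition poly2 :: "real poly poly \<Rightarrow> real \<Rightarrow> real \<Rightarrow> real" where
  "poly2 g x y = poly (poly g [:y:]) x"

text \<open>Total degree at most \<open>n\<close>; the zero polynomial satisfies this for every \<open>n\<close>.\<close>

definition deg2_le :: "real poly poly \<Rightarrow> nat \<Rightarrow> bool" where
  "deg2_le g n \<longleftrightarrow> (\<forall>i j. coeff2 g i j \<noteq> 0 \<longrightarrow> i + j \<le> n)"

definition varX :: "real poly poly" where
  "varX = [:[:0, 1:]:]"

definition varY :: "real poly poly" where
  "varY = [:0, 1:]"

definition const2 :: "real \<Rightarrow> real poly poly" where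
  "const2 c = [:[:c:]:]"

text \<open>Only the values \<open>q 0\<close>, ..., \<open>q 4\<close> matter.\<close>

definition curve_poly :: "(nat \<Rightarrow> real) \<Rightarrow> real poly poly" where
  "curve_poly q = varX * varY - (\<Sum>s\<le>4. const2 (q s) * varX ^ s)"

definition zero_set :: "real poly poly \<Rightarrow> (real \<times> real) set" where
  "zero_set p = {(x, y). poly2 p x y = 0}"

definition measure_supp :: "'a::topological_space measure \<Rightarrow> 'a set" where
  "measure_supp \<mu> = {x. \<forall>U. open U \<and> x \<in> U \<longrightarrow> emeasure \<mu> U > 0}"

text \<open>
  A truncated bisequence of degree \<open>2n\<close> is a function \<open>\<beta>\<close> of two indices, of which only the
  values \<open>\<beta> i j\<close> with \<open>i + j \<le> 2n\<close> are ever used. Integrability is stated separately because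
  the Bochner integral of a non-integrable function is 0 by convention.
\<close>

definition representing_measure ::
  "(real \<times> real) set \<Rightarrow> nat \<Rightarrow> (nat \<Rightarrow> nat \<Rightarrow> real) \<Rightarrow> (real \<times> real) measure \<Rightarrow> bool" where
  "representing_measure Z n \<beta> \<mu> \<longleftrightarrow>
     sets \<mu> = sets borel \<and> measure_supp \<mu> \<subseteq> Z \<and>
     (\<forall>i j. i + j \<le> 2 * n \<longrightarrow>
        integrable \<mu> (\<lambda>(x, y). x ^ i * y ^ j) \<and>
        \<beta> i j = (LINT (x, y)|\<mu>. x ^ i * y ^ j))"

text \<open>Rows and columns of \<open>M(n)\<close> are indexed by exponent pairs rather than by an ordering of them.\<close>

definition exponents :: "nat \<Rightarrow> (nat \<times> nat) set" where
  "exponents n = {(i, j). i + j \<le> n}"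

definition moment_matrix :: "(nat \<Rightarrow> nat \<Rightarrow> real) \<Rightarrow> nat \<times> nat \<Rightarrow> nat \<times> nat \<Rightarrow> real" where
  "moment_matrix \<beta> r c = \<beta> (fst r + fst c) (snd r + snd c)"

text \<open>The entry in row \<open>r\<close> of the combination \<open>g(X,Y)\<close> of columns of \<open>M(n)\<close>.\<close>

definition column_comb ::
  "nat \<Rightarrow> (nat \<Rightarrow> nat \<Rightarrow> real) \<Rightarrow> real poly poly \<Rightarrow> nat \<times> nat \<Rightarrow> real" where
  "column_comb n \<beta> g r =
     (\<Sum>c\<in>exponents n. coeff2 g (fst c) (snd c) * moment_matrix \<beta> r c)"

definition column_relation :: "nat \<Rightarrow> (nat \<Rightarrow> nat \<Rightarrow> real) \<Rightarrow> real poly poly \<Rightarrow> bool" where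
  "column_relation n \<beta> g \<longleftrightarrow> (\<forall>r\<in>exponents n. column_comb n \<beta> g r = 0)"

definition p_pure :: "real poly poly \<Rightarrow> nat \<Rightarrow> (nat \<Rightarrow> nat \<Rightarrow> real) \<Rightarrow> bool" where
  "p_pure p n \<beta> \<longleftrightarrow>
     (\<forall>g. deg2_le g n \<longrightarrow>
        (column_relation n \<beta> g \<longleftrightarrow> (\<exists>h. g = p * h \<and> deg2_le (p * h) n)))"

text \<open>\<open>lcoef q j t\<close> is the coefficient of x^t in the Laurent polynomial (sum_s q_s x^(s-1))^j.\<close>

definition lcoef :: "(nat \<Rightarrow> real) \<Rightarrow> nat \<Rightarrow> int \<Rightarrow> real" where
  "lcoef q j t =
     fls_nth ((\<Sum>s\<le>4. fls_const (q s) * fls_X_intpow (int s - 1)) ^ j) t"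

text \<open>
  The sequence \<open>\<gamma>\<close>, indexed by integers, is built by successive updates of a function that is 0
  at all indices not yet assigned. After stage \<open>k\<close> exactly the indices from \<open>-k\<close> to \<open>2n + 2k\<close>
  have been assigned, and for \<open>k \<le> 2n - 2\<close> each update only reads indices assigned before.
\<close>

definition gamma_step ::
  "(nat \<Rightarrow> real) \<Rightarrow> (nat \<Rightarrow> nat \<Rightarrow> real) \<Rightarrow> nat \<Rightarrow> nat \<Rightarrow> (int \<Rightarrow> real) \<Rightarrow> int \<Rightarrow> real" where
  "gamma_step q \<beta> n k g =
    (let
       g1 = g(- int k :=
              1 / q 0 ^ k * (\<beta> 0 k - (\<Sum>t = - int k + 1..3 * int k. lcoef q k t * g t)));
       g2 = g1(2 * int n + 2 * int k - 1 :=
              \<beta> (2 * n - k - 1) k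
              - (\<Sum>t = - int k..3 * int k - 1. lcoef q k t * g1 (t + 2 * int n - int k - 1)));
       g3 = g2(2 * int n + 2 * int k :=
              \<beta> (2 * n - k) k
              - (\<Sum>t = - int k..3 * int k - 1. lcoef q k t * g2 (t + 2 * int n - int k)))
     in g3)"

primrec gamma_stage ::
  "(nat \<Rightarrow> real) \<Rightarrow> (nat \<Rightarrow> nat \<Rightarrow> real) \<Rightarrow> nat \<Rightarrow> nat \<Rightarrow> int \<Rightarrow> real" where
  "gamma_stage q \<beta> n 0 = (\<lambda>i. if 0 \<le> i \<and> i \<le> 2 * int n then \<beta> (nat i) 0 else 0)"
| "gamma_stage q \<beta> n (Suc k) = gamma_step q \<beta> n (Suc k) (gamma_stage q \<beta> n k)"

text \<open>The part determined by \<open>\<beta>\<close> alone, indices \<open>-2n + 2\<close> to \<open>6n - 4\<close>.\<close>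

definition gamma_core :: "(nat \<Rightarrow> real) \<Rightarrow> (nat \<Rightarrow> nat \<Rightarrow> real) \<Rightarrow> nat \<Rightarrow> int \<Rightarrow> real" where
  "gamma_core q \<beta> n = gamma_stage q \<beta> n (2 * n - 2)"

text \<open>The part determined by \<open>\<beta>\<close> and \<open>t1\<close>, indices \<open>-2n + 1\<close> to \<open>6n - 2\<close>.\<close>

definition gamma1 ::
  "(nat \<Rightarrow> real) \<Rightarrow> (nat \<Rightarrow> nat \<Rightarrow> real) \<Rightarrow> nat \<Rightarrow> real \<Rightarrow> int \<Rightarrow> real" where
  "gamma1 q \<beta> n t1 =
    (let
       g1 = (gamma_core q \<beta> n)(6 * int n - 3 := t1);
       g2 = g1(- 2 * int n + 1 :=
              1 / q 0 ^ (2 * n - 1) * (\<beta> 0 (2 * n - 1)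
              - (\<Sum>t = - 2 * int n + 2..6 * int n - 3. lcoef q (2 * n - 1) t * g1 t)));
       g3 = g2(6 * int n - 2 :=
              \<beta> 1 (2 * n - 1)
              - (\<Sum>t = - 2 * int n + 1..6 * int n - 4. lcoef q (2 * n - 1) t * g2 (t + 1)))
     in g3)"

text \<open>The full sequence, indices \<open>-2n\<close> to \<open>6n\<close>.\<close>

definition gamma ::
  "(nat \<Rightarrow> real) \<Rightarrow> (nat \<Rightarrow> nat \<Rightarrow> real) \<Rightarrow> nat \<Rightarrow> real \<Rightarrow> real \<Rightarrow> real \<Rightarrow> int \<Rightarrow> real" where
  "gamma q \<beta> n t1 t2 t3 =
    (let g = (gamma1 q \<beta> n t1)(6 * int n - 1 := t2, 6 * int n := t3)
     in g(- 2 * int n :=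
          1 / q 0 ^ (2 * n) * (\<beta> 0 (2 * n)
          - (\<Sum>t = - 2 * int n + 1..6 * int n. lcoef q (2 * n) t * g t))))"

text \<open>Hankel matrix of size \<open>m\<close> and segment of length \<open>m\<close>, both starting at index \<open>lo\<close>.\<close>

definition hankel :: "(int \<Rightarrow> real) \<Rightarrow> int \<Rightarrow> nat \<Rightarrow> real mat" where
  "hankel g lo m = Matrix.mat m m (\<lambda>(i, j). g (lo + int i + int j))"

definition segment :: "(int \<Rightarrow> real) \<Rightarrow> int \<Rightarrow> nat \<Rightarrow> real Matrix.vec" where
  "segment g lo m = Matrix.vec m (\<lambda>i. g (lo + int i))"

definition pos_def :: "real mat \<Rightarrow> bool" where
  "pos_def A \<longleftrightarrow> square_mat A \<and> transpose_mat A = A \<and>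
     (\<forall>x\<in>carrier_vec (dim_row A). x \<noteq> 0\<^sub>v (dim_row A) \<longrightarrow> scalar_prod x (A *\<^sub>v x) > 0)"

text \<open>Unspecified for singular matrices, for which \<open>mat_inverse\<close> returns \<open>None\<close>.\<close>

definition mat_inv :: "real mat \<Rightarrow> real mat" where
  "mat_inv A = the (mat_inverse A)"

text \<open>The rank-one matrix c c^T.\<close>

definition outer :: "real Matrix.vec \<Rightarrow> real mat" where
  "outer c = Matrix.mat (dim_vec c) (dim_vec c) (\<lambda>(i, j). vec_index c i * vec_index c j)"

definition A_gamma :: "(nat \<Rightarrow> real) \<Rightarrow> (nat \<Rightarrow> nat \<Rightarrow> real) \<Rightarrow> nat \<Rightarrow> real mat" where
  "A_gamma q \<beta> n = hankel (gamma_core q \<beta> n) (- 2 * int n + 2) (4 * n - 2)"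

definition F1 :: "(nat \<Rightarrow> real) \<Rightarrow> (nat \<Rightarrow> nat \<Rightarrow> real) \<Rightarrow> nat \<Rightarrow> real \<Rightarrow> real mat" where
  "F1 q \<beta> n t1 = hankel (gamma1 q \<beta> n t1) (- 2 * int n + 2) (4 * n - 1)"

definition d_fun :: "(nat \<Rightarrow> real) \<Rightarrow> (nat \<Rightarrow> nat \<Rightarrow> real) \<Rightarrow> nat \<Rightarrow> real \<Rightarrow> real" where
  "d_fun q \<beta> n t1 = Determinant.det (F1 q \<beta> n t1)"

end

theory Submission
  imports Defs "HOL-Computational_Algebra.Fundamental_Theorem_Algebra"
begin

text \<open>
  Since \<open>q 0 \<noteq> 0\<close>, the curve is the graph of the Laurent polynomial \<open>y = (\<Sum>s. q s x^s) / x\<close> over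
  \<open>x \<noteq> 0\<close>, so a representing measure for \<open>\<beta>\<close> amounts to a measure on the punctured line with
  moments \<open>\<gamma>\<close> of orders \<open>-2n\<close> to \<open>6n\<close>: the equations defining \<open>\<gamma>\<close> are the moment identities
  for column 0 and for the two top antidiagonals, and the recursion coming from \<open>p\<close>-purity
  propagates them to all indices. After multiplication of the measure by \<open>x^(2n)\<close> this is a truncated
  Hamburger problem with a quadrature without node 0. It is solvable because the Hankel matrix of
  \<open>\<gamma>\<close> is positive definite, being obtained from \<open>A_gamma\<close> by three borderings whose Schur
  complements are positive: \<open>w1\<close> because \<open>d\<close> is a concave quadratic, positive strictly between its
  zeros, and the other two by the last two inequalities, read through block inversion.
\<close>

section \<open>Gaussian quadrature with nonzero nodes\<close>

text \<open>The relation \<open>x * y = (\<Sum>s\<le>4. q s * x ^ s)\<close> times a monomial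
  rewrites \<open>\<beta> (i + 1) (j + 1)\<close> through entries of degree up to i + j + 4, which
  must not exceed 2n. So it reaches neither row 0 nor column 0, nor the degrees 2n - 1 and 2n.
  Exactly these entries are imposed as equations on \<gamma>; outside row 0 each is solved for an
  extreme index, whose coefficient is a power of \<open>q 0\<close> at the bottom and 1 at the top.
  There are 8n + 1 unknowns and 8n - 2 equations, row 0 included, hence three free parameters: the
  equations for \<open>\<beta> 0 (2 * n - 1)\<close> and \<open>\<beta> 0 (2 * n)\<close> belong
  both to column 0 and to a top antidiagonal and meet unassigned indices at both ends. The remaining
  moment problem has even top order 2m with m = 4n. A rule with m + 1 nodes that is exact only up to
  degree 2m, not 2m + 1, leaves one parameter free in its node polynomial, and this is the room in
  which 0 is kept away from the nodes.\<close>

definition moment_functional :: "(nat \<Rightarrow> real) \<Rightarrow> real poly \<Rightarrow> real" where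
  "moment_functional \<sigma> f = (\<Sum>i\<le>Polynomial.degree f. Polynomial.coeff f i * \<sigma> i)"

lemma moment_functional_eq:
  assumes "Polynomial.degree f \<le> N"
  shows "moment_functional \<sigma> f = (\<Sum>i\<le>N. Polynomial.coeff f i * \<sigma> i)"
  unfolding moment_functional_def
  by (rule sum.mono_neutral_left) (use assms in \<open>auto simp: coeff_eq_0\<close>)

lemma moment_functional_0 [simp]: "moment_functional \<sigma> 0 = 0"
  by (simp add: moment_functional_def)

lemma moment_functional_add:
  "moment_functional \<sigma> (f + g) = moment_functional \<sigma> f + moment_functional \<sigma> g"
proof -
  let ?N = "max (Polynomial.degree f) (Polynomial.degree g)"
  have "Polynomial.degree (f + g) \<le> ?N" by (rule degree_add_le_max)
  then show ?thesis
    by (simp add: moment_functional_eq[where N = ?N] distrib_right sum.distrib)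
qed

lemma moment_functional_smult:
  "moment_functional \<sigma> (Polynomial.smult c f) = c * moment_functional \<sigma> f"
  by (simp add: moment_functional_eq[where N = "Polynomial.degree f"] sum_distrib_left mult.assoc)

lemma moment_functional_minus: "moment_functional \<sigma> (- f) = - moment_functional \<sigma> f"
  using moment_functional_smult[of \<sigma> "-1" f] by simp

lemma moment_functional_diff:
  "moment_functional \<sigma> (f - g) = moment_functional \<sigma> f - moment_functional \<sigma> g"
  using moment_functional_add[of \<sigma> f "- g"] by (simp add: moment_functional_minus)

lemma moment_functional_sum:
  "moment_functional \<sigma> (\<Sum>i\<in>I. f i) = (\<Sum>i\<in>I. moment_functional \<sigma> (f i))"
  by (induction I rule: infinite_finite_induct) (simp_all add: moment_functional_add)

lemma moment_functional_monom: "moment_functional \<sigma> (Polynomial.monom c k) = c * \<sigma> k"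
  by (subst moment_functional_eq[where N = k]) (simp_all add: degree_monom_le if_distrib[where f = "\<lambda>x. x * _"] cong: if_cong)

text \<open>Only moments up to order \<open>2 * m\<close> enter: this is positive definiteness of
  the Hankel matrix of size \<open>m + 1\<close>.\<close>

definition positive_functional :: "(nat \<Rightarrow> real) \<Rightarrow> nat \<Rightarrow> bool" where
  "positive_functional \<sigma> m \<longleftrightarrow>
     (\<forall>f. Polynomial.degree f \<le> m \<longrightarrow> f \<noteq> 0 \<longrightarrow> moment_functional \<sigma> (f * f) > 0)"

section \<open>Orthogonal polynomials of a positive functional\<close>

lemma degree_diff_monic_less:
  fixes f g :: "real poly"
  assumes "Polynomial.degree f = k" "Polynomial.degree g = k"
    "Polynomial.lead_coeff f = Polynomial.lead_coeff g" "k > 0"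
  shows "Polynomial.degree (f - g) < k"
proof -
  have "Polynomial.degree (f - g) \<le> k" using assms by (intro degree_diff_le) auto
  moreover have "Polynomial.coeff (f - g) k = 0" using assms by simp
  ultimately show ?thesis
    using assms(4) by (metis degree_0 leading_coeff_0_iff le_neq_implies_less)
qed

text \<open>Gram-Schmidt: the induction step subtracts the component of \<open>f\<close> along the
  orthogonal polynomial of degree \<open>k\<close>, which itself comes from the induction hypothesis
  applied to x^k. Norms are known to be positive only up to degree \<open>m\<close>, hence
  \<open>k \<le> Suc m\<close>, while \<open>f\<close> is arbitrary. The disjunct
  \<open>h = 0\<close> is there because the zero polynomial has degree 0 and is the only choice for
  \<open>k = 0\<close>.\<close>

lemma orthogonal_projection:
  assumes "positive_functional \<sigma> m" "k \<le> Suc m"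
  shows "\<exists>h. (h = 0 \<or> Polynomial.degree h < k) \<and>
    (\<forall>g. g = 0 \<or> Polynomial.degree g < k \<longrightarrow> moment_functional \<sigma> ((f - h) * g) = 0)"
  using assms(2)
proof (induction k arbitrary: f)
  case 0
  show ?case by (intro exI[of _ 0]) auto
next
  case (Suc k)
  let ?L = "moment_functional \<sigma>"
  obtain h where h: "h = 0 \<or> Polynomial.degree h < k"
    and orth: "\<And>g. g = 0 \<or> Polynomial.degree g < k \<Longrightarrow> ?L ((f - h) * g) = 0"
    using Suc.IH[of f] Suc.prems Suc_leD by blast
  obtain h1 where h1: "h1 = 0 \<or> Polynomial.degree h1 < k"
    and orth1: "\<And>g. g = 0 \<or> Polynomial.degree g < k \<Longrightarrow>
      ?L ((Polynomial.monom 1 k - h1) * g) = 0"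
    using Suc.IH[of "Polynomial.monom 1 k"] Suc.prems Suc_leD by blast
  define p where "p = Polynomial.monom 1 k - h1"
  have cp: "Polynomial.coeff p k = 1"
    using h1 by (auto simp: p_def coeff_eq_0)
  have dp: "Polynomial.degree p \<le> k"
    unfolding p_def using h1 by (intro degree_diff_le) (auto simp: degree_monom_le)
  have p0: "p \<noteq> 0" using cp by auto
  have pp: "?L (p * p) > 0"
    using assms(1) dp p0 Suc.prems by (simp add: positive_functional_def)
  define c where "c = ?L ((f - h) * p) / ?L (p * p)"
  have orth_p: "?L ((f - (h + Polynomial.smult c p)) * p) = 0"
  proof -
    have "(f - (h + Polynomial.smult c p)) * p = (f - h) * p - Polynomial.smult c (p * p)"
      by (simp add: algebra_simps)
    then show ?thesis
      using pp by (simp add: c_def moment_functional_diff moment_functional_smult)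
  qed
  have orth_low: "?L ((f - (h + Polynomial.smult c p)) * g) = 0"
    if "g = 0 \<or> Polynomial.degree g < k" for g
  proof -
    have "(f - (h + Polynomial.smult c p)) * g = (f - h) * g - Polynomial.smult c (p * g)"
      by (simp add: algebra_simps)
    then show ?thesis
      using orth[OF that] orth1[OF that]
      by (simp add: moment_functional_diff moment_functional_smult p_def)
  qed
  show ?case
  proof (intro exI[of _ "h + Polynomial.smult c p"] conjI allI impI)
    have "Polynomial.degree (h + Polynomial.smult c p) \<le> k"
      using h dp by (intro degree_add_le) (auto intro: order_trans[OF degree_smult_le])
    then show "h + Polynomial.smult c p = 0 \<or> Polynomial.degree (h + Polynomial.smult c p) < Suc k"
      by simp
  next
    fix g :: "real poly" assume g: "g = 0 \<or> Polynomial.degree g < Suc k"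
    define b where "b = Polynomial.coeff g k"
    define g1 where "g1 = g - Polynomial.smult b p"
    have "Polynomial.degree g1 \<le> k"
      unfolding g1_def using g dp
      by (intro degree_diff_le) (auto intro: order_trans[OF degree_smult_le])
    moreover have "Polynomial.coeff g1 k = 0" by (simp add: g1_def b_def cp)
    ultimately have "g1 = 0 \<or> Polynomial.degree g1 < k"
      using le_neq_implies_less by (metis leading_coeff_0_iff)
    note orth_low[OF this]
    moreover have "g = g1 + Polynomial.smult b p" by (simp add: g1_def)
    ultimately show "?L ((f - (h + Polynomial.smult c p)) * g) = 0"
      using orth_p by (simp add: distrib_left moment_functional_add moment_functional_smult)
  qed
qed

text \<open>The degree \<open>d\<close> is decoupled from \<open>k\<close> because the quadrature
  needs degree \<open>m + 1\<close> with orthogonality only below \<open>m\<close>: the products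
  then have degree at most \<open>2 * m\<close>, the last order under control.\<close>

lemma orthogonal_monic_poly:
  assumes "positive_functional \<sigma> m" "k \<le> Suc m" "k \<le> d"
  obtains p where "Polynomial.degree p = d" "Polynomial.lead_coeff p = 1"
    "\<And>g. g = 0 \<or> Polynomial.degree g < k \<Longrightarrow> moment_functional \<sigma> (p * g) = 0"
proof -
  obtain h where h: "h = 0 \<or> Polynomial.degree h < k"
    and orth: "\<And>g. g = 0 \<or> Polynomial.degree g < k \<Longrightarrow>
      moment_functional \<sigma> ((Polynomial.monom 1 d - h) * g) = 0"
    using orthogonal_projection[OF assms(1,2), of "Polynomial.monom 1 d"] by blast
  let ?p = "Polynomial.monom 1 d - h"
  have c: "Polynomial.coeff ?p d = 1" using h assms(3) by (auto simp: coeff_eq_0)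
  have "Polynomial.degree ?p \<le> d"
    using h assms(3) by (intro degree_diff_le) (auto simp: degree_monom_le)
  moreover have "Polynomial.degree ?p \<ge> d" using c by (intro le_degree) simp
  ultimately have "Polynomial.degree ?p = d" by simp
  then show ?thesis using that[of ?p] c orth by simp
qed

text \<open>If the orthogonal polynomial of degree \<open>m\<close> vanishes at 0, write it as \<open>x r\<close>, and the one of
  degree \<open>m + 1\<close> as \<open>x t\<close> if it vanishes too. Then \<open>L (x r t)\<close> is zero by the second
  orthogonality and equals \<open>L ((x r)\<^sup>2)\<close> by the first.\<close>

lemma quasi_orthogonal_poly_nonzero_at_0:
  assumes pos: "positive_functional \<sigma> m" and "m > 0"
  obtains p where "Polynomial.degree p = Suc m" "Polynomial.lead_coeff p = 1" "poly p 0 \<noteq> 0"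
    "\<And>g. g = 0 \<or> Polynomial.degree g < m \<Longrightarrow> moment_functional \<sigma> (p * g) = 0"
proof -
  let ?L = "moment_functional \<sigma>"
  obtain p where p: "Polynomial.degree p = m" "Polynomial.lead_coeff p = 1"
    "\<And>g. g = 0 \<or> Polynomial.degree g < m \<Longrightarrow> ?L (p * g) = 0"
    using orthogonal_monic_poly[OF pos, of m m] by auto
  obtain s where s: "Polynomial.degree s = Suc m" "Polynomial.lead_coeff s = 1"
    "\<And>g. g = 0 \<or> Polynomial.degree g < m \<Longrightarrow> ?L (s * g) = 0"
    using orthogonal_monic_poly[OF pos, of m "Suc m"] by auto
  show thesis
  proof (cases "poly s 0 = 0")
    case False
    then show ?thesis using that s by blast
  next
    case s0: True
    show ?thesis
    proof (cases "poly p 0 = 0")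
      case False
      \<comment> \<open>Adding the orthogonal polynomial of lower degree preserves degree, leading
        coefficient and orthogonality, and moves the value at 0 away from 0.\<close>
      have "Polynomial.degree (s + p) = Suc m"
        using p s by (simp add: degree_add_eq_left)
      moreover have "Polynomial.lead_coeff (s + p) = 1"
        using p(1) s(1,2) calculation by (simp add: coeff_eq_0)
      ultimately show ?thesis
        using that[of "s + p"] False s0 p(3) s(3)
        by (simp add: distrib_right moment_functional_add)
    next
      case p0: True
      obtain r where r: "p = [:0, 1:] * r" using p0 poly_eq_0_iff_dvd[of p 0] by (auto elim!: dvdE)
      obtain t where t: "s = [:0, 1:] * t" using s0 poly_eq_0_iff_dvd[of s 0] by (auto elim!: dvdE)
      have "r \<noteq> 0" using p assms(2) r by auto
      then have dr: "Polynomial.degree r < m" using p(1) r by simp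
      have "t \<noteq> 0" using s t by auto
      then have dt: "Polynomial.degree t = m" "Polynomial.lead_coeff t = 1" using s t by auto
      have "Polynomial.degree (t - p) < m"
        using p dt assms(2) by (intro degree_diff_monic_less) auto
      then have "?L (p * t) = ?L (p * p)"
        using p(3)[of "t - p"] by (simp add: right_diff_distrib moment_functional_diff)
      moreover have "p \<noteq> 0" using p(2) by auto
      then have "?L (p * p) > 0" using pos p by (simp add: positive_functional_def)
      moreover have "p * t = s * r" by (simp add: r t)
      ultimately show ?thesis using s(3)[of r] dr by simp
    qed
  qed
qed

section \<open>Zeros of quasi-orthogonal polynomials\<close>

lemma map_poly_of_real_mult:
  "map_poly complex_of_real (p * q) = map_poly complex_of_real p * map_poly complex_of_real q"
  by (intro poly_eqI) (simp add: coeff_map_poly coeff_mult)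

lemma map_poly_of_real_add:
  "map_poly complex_of_real (p + q) = map_poly complex_of_real p + map_poly complex_of_real q"
  by (intro poly_eqI) (simp add: coeff_map_poly)

lemma poly_map_poly_of_real:
  "poly (map_poly complex_of_real p) (complex_of_real x) = complex_of_real (poly p x)"
  by (induction p) (simp_all add: map_poly_pCons)

text \<open>The remainder modulo the real quadratic with zeros z and its conjugate is a + b x with
  real a and b; vanishing at a nonreal point forces b = 0 and then a = 0.\<close>

lemma real_poly_nonreal_root_quadratic_dvd:
  fixes p :: "real poly"
  assumes "poly (map_poly complex_of_real p) z = 0" "Im z \<noteq> 0"
  shows "[:(Re z)\<^sup>2 + (Im z)\<^sup>2, - 2 * Re z, 1:] dvd p"
proof -
  define d where "d = [:(Re z)\<^sup>2 + (Im z)\<^sup>2, - 2 * Re z, 1:]"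
  define e where "e = p mod d"
  have d0: "poly (map_poly complex_of_real d) z = 0"
    by (simp add: d_def map_poly_pCons complex_eq_iff power2_eq_square algebra_simps)
  have "Polynomial.degree e < 2"
    using degree_mod_less[of d p] by (auto simp: e_def d_def)
  then have "e = [:Polynomial.coeff e 0, Polynomial.coeff e 1:]"
    by (intro poly_eqI) (auto simp: coeff_pCons coeff_eq_0 split: nat.split)
  then obtain a b where e: "e = [:a, b:]" by blast
  have "p = d * (p div d) + e" by (simp add: e_def)
  then have "map_poly complex_of_real p = map_poly complex_of_real d * map_poly complex_of_real (p div d)
      + map_poly complex_of_real e"
    by (metis map_poly_of_real_add map_poly_of_real_mult)
  then have "poly (map_poly complex_of_real e) z = 0" using assms(1) d0 by simp
  then have "a + Re z * b = 0" "Im z * b = 0" by (simp_all add: e map_poly_pCons complex_eq_iff)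
  then have "e = 0" using assms(2) by (simp add: e)
  then show ?thesis by (simp add: e_def d_def mod_eq_0_iff_dvd)
qed

lemma prod_linear_factors_dvd:
  fixes p :: "real poly"
  assumes "finite S" "\<And>x. x \<in> S \<Longrightarrow> poly p x = 0"
  shows "(\<Prod>x\<in>S. [:- x, 1:]) dvd p"
  using assms
proof (induction S arbitrary: p rule: finite_induct)
  case empty
  show ?case by simp
next
  case (insert x S)
  have "[:- x, 1:] dvd p" using insert.prems by (simp add: poly_eq_0_iff_dvd)
  then obtain c where c: "p = [:- x, 1:] * c" by (elim dvdE)
  have "poly c y = 0" if "y \<in> S" for y
    using insert.prems[of y] insert.hyps(2) that by (auto simp: c)
  then have "(\<Prod>x\<in>S. [:- x, 1:]) dvd c" by (rule insert.IH)
  then show ?case unfolding c prod.insert[OF insert.hyps] by (intro mult_dvd_mono dvd_refl)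
qed

text \<open>A repeated real zero or a conjugate pair would make \<open>p\<close> a multiple of (x -
  a)^2 + b^2 with a cofactor r of degree m - 1. Then r is an admissible test polynomial, yet L(p r)
  = L(((x - a) r)^2) + b^2 L(r^2) > 0.\<close>

lemma quasi_orthogonal_poly_roots:
  assumes pos: "positive_functional \<sigma> m"
    and p: "Polynomial.degree p = Suc m"
    and orth: "\<And>g. g = 0 \<or> Polynomial.degree g < m \<Longrightarrow> moment_functional \<sigma> (p * g) = 0"
  shows "card {x. poly p x = 0} = Suc m"
proof -
  let ?L = "moment_functional \<sigma>"
  define S where "S = {x. poly p x = 0}"
  have p0: "p \<noteq> 0" using p by auto
  have fin: "finite S" unfolding S_def using p0 by (rule poly_roots_finite)
  \<comment> \<open>The case b = 0 is a double real zero, the case of nonzero b a conjugate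
    pair.\<close>
  have no_square: False if "p = [:a\<^sup>2 + b\<^sup>2, - 2 * a, 1:] * r" for a b r
  proof -
    have r0: "r \<noteq> 0" using that p0 by auto
    then have "Polynomial.degree p = 2 + Polynomial.degree r"
      unfolding that by (subst degree_mult_eq) auto
    then have dr: "Suc (Polynomial.degree r) = m" using p by simp
    let ?u = "[:- a, 1:] * r"
    have u0: "?u \<noteq> 0" using r0 by (simp only: mult_eq_0_iff) simp
    then have "Polynomial.degree ?u = m"
      using dr r0 by (subst degree_mult_eq) auto
    then have "?L (?u * ?u) > 0" using pos u0 unfolding positive_functional_def by blast
    moreover have "?L (r * r) > 0" using pos dr r0 by (simp add: positive_functional_def)
    moreover have "p * r = ?u * ?u + Polynomial.smult (b\<^sup>2) (r * r)"
      unfolding poly_eq_poly_eq_iff[symmetric] that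
      by (rule ext) (simp add: power2_eq_square algebra_simps)
    ultimately have "?L (p * r) > 0"
      by (simp add: moment_functional_add moment_functional_smult add_pos_nonneg)
    then show False using orth[of r] dr by simp
  qed
  have "(\<Prod>x\<in>S. [:- x, 1:]) dvd p"
    using fin by (intro prod_linear_factors_dvd) (auto simp: S_def)
  \<comment> \<open>A zero of the cofactor \<open>s\<close> would be a nonreal zero of
    \<open>p\<close> or a repeated real one, so \<open>s\<close> must be constant.\<close>
  then obtain s where s: "p = (\<Prod>x\<in>S. [:- x, 1:]) * s" by (elim dvdE)
  have s0: "s \<noteq> 0" using s p0 by auto
  have dS: "Polynomial.degree (\<Prod>x\<in>S. [:- x, 1:]) = card S"
    by (subst degree_prod_eq_sum_degree) auto
  have "Polynomial.degree s = 0"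
  proof (rule ccontr)
    assume "Polynomial.degree s \<noteq> 0"
    then have "\<not> constant (poly (map_poly complex_of_real s))"
      by (simp add: constant_degree degree_map_poly)
    then obtain z where z: "poly (map_poly complex_of_real s) z = 0"
      using fundamental_theorem_of_algebra by blast
    show False
    proof (cases "Im z = 0")
      case False
      then have "[:(Re z)\<^sup>2 + (Im z)\<^sup>2, - 2 * Re z, 1:] dvd s"
        by (rule real_poly_nonreal_root_quadratic_dvd[OF z])
      then have "[:(Re z)\<^sup>2 + (Im z)\<^sup>2, - 2 * Re z, 1:] dvd p" unfolding s by (rule dvd_mult)
      then show False using no_square by (elim dvdE) blast
    next
      case True
      then obtain x where "z = complex_of_real x" by (metis complex_is_Real_iff Reals_cases)
      then have x: "poly s x = 0" using z by (simp add: poly_map_poly_of_real)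
      then have "poly p x = 0" by (subst s) simp
      then have "x \<in> S" by (simp add: S_def)
      then have "[:- x, 1:] dvd (\<Prod>x\<in>S. [:- x, 1:])" using fin by (rule dvd_prodI[rotated])
      moreover have "[:- x, 1:] dvd s" using x by (simp add: poly_eq_0_iff_dvd)
      ultimately have "[:- x, 1:] * [:- x, 1:] dvd p" unfolding s by (rule mult_dvd_mono)
      moreover have "[:- x, 1:] * [:- x, 1:] = [:x\<^sup>2 + 0\<^sup>2, - 2 * x, 1:]"
        by (simp add: power2_eq_square)
      ultimately show False using no_square[of x 0] by (metis dvdE)
    qed
  qed
  moreover have "(\<Prod>x\<in>S. [:- x, 1:]) \<noteq> 0" using fin by simp
  then have "Polynomial.degree ((\<Prod>x\<in>S. [:- x, 1:]) * s) = card S + Polynomial.degree s"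
    using s0 dS by (simp add: degree_mult_eq)
  ultimately have "Polynomial.degree p = card S" using s by simp
  then show ?thesis using p by (simp add: S_def)
qed

text \<open>For \<open>f\<close> of degree at most 2m, the difference from the sum of f(r) l_r^2
  vanishes at all nodes, hence is p g with g of degree below m, and L annihilates it. Interpolating
  by squares of the Lagrange polynomials makes the weights L(l_r^2) visibly positive.\<close>

lemma gauss_quadrature_nonzero_nodes:
  assumes pos: "positive_functional \<sigma> m" and "m > 0"
  obtains S :: "real set" and w where "finite S" "0 \<notin> S" "\<And>r. r \<in> S \<Longrightarrow> w r > 0"
    "\<And>k. k \<le> 2 * m \<Longrightarrow> \<sigma> k = (\<Sum>r\<in>S. w r * r ^ k)"
proof -
  let ?L = "moment_functional \<sigma>"
  obtain p where p: "Polynomial.degree p = Suc m" "Polynomial.lead_coeff p = 1" "poly p 0 \<noteq> 0"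
    and orth: "\<And>g. g = 0 \<or> Polynomial.degree g < m \<Longrightarrow> ?L (p * g) = 0"
    using quasi_orthogonal_poly_nonzero_at_0[OF assms] by blast
  define S where "S = {x. poly p x = 0}"
  have p0: "p \<noteq> 0" using p by auto
  have fin: "finite S" unfolding S_def using p0 by (rule poly_roots_finite)
  have card: "card S = Suc m"
    unfolding S_def using quasi_orthogonal_poly_roots[OF pos p(1) orth] by simp
  define l where "l r = (\<Prod>s\<in>S - {r}. Polynomial.smult (1 / (r - s)) [:- s, 1:])" for r
  have l_self: "poly (l r) r = 1" for r
    unfolding l_def poly_prod by (rule prod.neutral) (auto simp: divide_simps)
  have l_other: "poly (l r) s = 0" if "s \<in> S" "s \<noteq> r" for r s
    unfolding l_def poly_prod using fin that by (intro prod_zero) auto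
  have l_deg: "Polynomial.degree (l r) \<le> m" if "r \<in> S" for r
  proof -
    have "Polynomial.degree (l r) \<le> (\<Sum>s\<in>S - {r}. Polynomial.degree (Polynomial.smult (1 / (r - s)) [:- s, 1:]))"
      unfolding l_def using fin by (intro degree_prod_sum_le[of "S - {r}", unfolded comp_def]) auto
    also have "\<dots> \<le> (\<Sum>s\<in>S - {r}. 1)"
      by (intro sum_mono) simp
    also have "\<dots> = m" using that card fin by simp
    finally show ?thesis .
  qed
  have l0: "l r \<noteq> 0" for r using l_self[of r] by auto
  have eq: "?L f = (\<Sum>r\<in>S. poly f r * ?L (l r * l r))" if f: "Polynomial.degree f \<le> 2 * m" for f
  proof -
    define e where "e = f - (\<Sum>r\<in>S. Polynomial.smult (poly f r) (l r * l r))"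
    have "poly e s = 0" if "s \<in> S" for s
    proof -
      have "(\<Sum>r\<in>S. poly f r * (poly (l r) s * poly (l r) s)) = (\<Sum>r\<in>S. if r = s then poly f s else 0)"
        using that by (intro sum.cong) (auto simp: l_self l_other)
      then show ?thesis using that fin by (simp add: e_def poly_sum)
    qed
    then have "(\<Prod>x\<in>S. [:- x, 1:]) dvd e"
      using fin by (intro prod_linear_factors_dvd) auto
    \<comment> \<open>\<open>p\<close> is monic and has as many distinct zeros as its degree, so the
      cofactor is the constant 1.\<close>
    moreover have "(\<Prod>x\<in>S. [:- x, 1:]) = p"
    proof -
      have "(\<Prod>x\<in>S. [:- x, 1:]) dvd p"
        using fin by (intro prod_linear_factors_dvd) (auto simp: S_def)
      then obtain c where c: "p = (\<Prod>x\<in>S. [:- x, 1:]) * c" by (elim dvdE)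
      have "Polynomial.degree (\<Prod>x\<in>S. [:- x, 1:]) = card S"
        by (subst degree_prod_eq_sum_degree) auto
      moreover have "Polynomial.degree p = Polynomial.degree (\<Prod>x\<in>S. [:- x, 1:]) + Polynomial.degree c"
        unfolding c by (rule degree_mult_eq) (use c p0 in auto)
      ultimately have "Polynomial.degree c = 0" using p card by simp
      then obtain a where a: "c = [:a:]" by (rule degree_eq_zeroE)
      have "Polynomial.lead_coeff p = a"
        unfolding c a lead_coeff_mult by (simp add: lead_coeff_prod)
      then show ?thesis using c a p by simp
    qed
    ultimately obtain g where g: "e = p * g" by (elim dvdE) auto
    have "Polynomial.degree (\<Sum>r\<in>S. Polynomial.smult (poly f r) (l r * l r)) \<le> 2 * m"
    proof (intro degree_sum_le fin order_trans[OF degree_smult_le])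
      fix r assume "r \<in> S"
      then show "Polynomial.degree (l r * l r) \<le> 2 * m"
        using l_deg[of r] degree_mult_le[of "l r" "l r"] by simp
    qed
    then have "Polynomial.degree e \<le> 2 * m" unfolding e_def using f by (intro degree_diff_le)
    then have "g = 0 \<or> Polynomial.degree g < m"
      using g p(1) p0 by (cases "g = 0") (auto simp: degree_mult_eq)
    then have "?L e = 0" unfolding g by (rule orth)
    then show ?thesis
      by (simp add: e_def moment_functional_diff moment_functional_sum moment_functional_smult)
  qed
  show thesis
  proof (rule that[of S "\<lambda>r. ?L (l r * l r)"])
    show "0 \<notin> S" using p by (simp add: S_def)
    show "?L (l r * l r) > 0" if "r \<in> S" for r
      using pos l_deg[OF that] l0 by (simp add: positive_functional_def)
    show "\<sigma> k = (\<Sum>r\<in>S. ?L (l r * l r) * r ^ k)" if "k \<le> 2 * m" for k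
      using eq[of "Polynomial.monom 1 k"] that
      by (simp add: moment_functional_monom degree_monom_eq poly_monom mult.commute)
  qed (rule fin)
qed

section \<open>Positive definite Hankel matrices and bordering\<close>

text \<open>Phrased with plain functions and sums, so that bordering amounts to splitting off a
  summand instead of handling block matrices. Only the values of \<open>x\<close> below
  \<open>m\<close> count.\<close>

definition hankel_pos :: "(int \<Rightarrow> real) \<Rightarrow> int \<Rightarrow> nat \<Rightarrow> bool" where
  "hankel_pos g lo m \<longleftrightarrow> (\<forall>x. (\<exists>i<m. x i \<noteq> 0) \<longrightarrow>
     (\<Sum>i<m. \<Sum>j<m. g (lo + int i + int j) * x i * x j) > 0)"

lemma hankel_carrier [simp]: "hankel g lo m \<in> carrier_mat m m"
  and dim_hankel [simp]: "dim_row (hankel g lo m) = m" "dim_col (hankel g lo m) = m"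
  and segment_carrier [simp]: "segment g lo m \<in> carrier_vec m"
  and dim_segment [simp]: "dim_vec (segment g lo m) = m"
  and segment_index [simp]: "i < m \<Longrightarrow> vec_index (segment g lo m) i = g (lo + int i)"
  by (simp_all add: hankel_def segment_def)

lemma hankel_cong:
  assumes "\<And>k. lo \<le> k \<Longrightarrow> k \<le> lo + 2 * int m - 2 \<Longrightarrow> g k = h k"
  shows "hankel g lo m = hankel h lo m"
  unfolding hankel_def by (rule cong_mat) (auto intro!: assms)

lemma segment_cong:
  assumes "\<And>k. lo \<le> k \<Longrightarrow> k \<le> lo + int m - 1 \<Longrightarrow> g k = h k"
  shows "segment g lo m = segment h lo m"
  unfolding segment_def by (intro eq_vecI) (auto intro!: assms)

lemma scalar_prod_sum_lessThan:
  "scalar_prod v w = (\<Sum>i<dim_vec w. vec_index v i * vec_index w i)"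
  by (simp add: scalar_prod_def atLeast0LessThan)

lemma hankel_mult_vec_index:
  assumes "x \<in> carrier_vec m" "i < m"
  shows "vec_index (hankel g lo m *\<^sub>v x) i = (\<Sum>j<m. g (lo + int i + int j) * vec_index x j)"
  using assms by (auto simp: hankel_def scalar_prod_sum_lessThan intro!: sum.cong)

lemma pos_def_hankel_iff: "pos_def (hankel g lo m) \<longleftrightarrow> hankel_pos g lo m"
proof -
  have sym: "transpose_mat (hankel g lo m) = hankel g lo m"
    by (rule eq_matI) (simp_all add: hankel_def add.assoc add.left_commute add.commute)
  have form: "scalar_prod x (hankel g lo m *\<^sub>v x) =
      (\<Sum>i<m. \<Sum>j<m. g (lo + int i + int j) * vec_index x i * vec_index x j)"
    if "x \<in> carrier_vec m" for x
    using that by (auto simp: scalar_prod_sum_lessThan hankel_mult_vec_index sum_distrib_left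
        mult_ac simp del: index_mult_mat_vec intro!: sum.cong)
  have nz: "x \<noteq> 0\<^sub>v m \<longleftrightarrow> (\<exists>i<m. vec_index x i \<noteq> 0)" if "x \<in> carrier_vec m" for x :: "real Matrix.vec"
    using that by (auto simp: vec_eq_iff)
  show ?thesis
  proof
    assume pd: "pos_def (hankel g lo m)"
    show "hankel_pos g lo m"
      unfolding hankel_pos_def
    proof (intro allI impI)
      fix x :: "nat \<Rightarrow> real" assume x: "\<exists>i<m. x i \<noteq> 0"
      let ?x = "Matrix.vec m x"
      have xc: "?x \<in> carrier_vec m" by simp
      have "?x \<noteq> 0\<^sub>v m" using x unfolding nz[OF xc] by auto
      then have "scalar_prod ?x (hankel g lo m *\<^sub>v ?x) > 0"
        using pd xc unfolding pos_def_def by simp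
      then show "(\<Sum>i<m. \<Sum>j<m. g (lo + int i + int j) * x i * x j) > 0"
        unfolding form[OF xc] by simp
    qed
  next
    assume "hankel_pos g lo m"
    then show "pos_def (hankel g lo m)"
      unfolding pos_def_def using sym
      by (auto simp: form nz hankel_pos_def simp del: index_mult_mat_vec)
  qed
qed

section \<open>Bordered quadratic forms\<close>

lemma sum_complete_square:
  fixes M :: "nat \<Rightarrow> nat \<Rightarrow> real"
  assumes sym: "\<And>i j. M i j = M j i"
    and u: "\<And>i. i < m \<Longrightarrow> (\<Sum>j<m. M i j * u j) = c i"
  shows "(\<Sum>i<m. \<Sum>j<m. M i j * (x i + s * u i) * (x j + s * u j)) =
    (\<Sum>i<m. \<Sum>j<m. M i j * x i * x j) + 2 * s * (\<Sum>i<m. c i * x i) + s\<^sup>2 * (\<Sum>i<m. c i * u i)"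
proof -
  have 1: "(\<Sum>i<m. \<Sum>j<m. M i j * y i * u j) = (\<Sum>i<m. c i * y i)" for y
  proof (intro sum.cong refl)
    fix i assume "i \<in> {..<m}"
    then have "c i = (\<Sum>j<m. M i j * u j)" by (simp add: u)
    then show "(\<Sum>j<m. M i j * y i * u j) = c i * y i"
      by (simp only: sum_distrib_right) (simp add: mult_ac)
  qed
  have 2: "(\<Sum>i<m. \<Sum>j<m. M i j * u i * y j) = (\<Sum>i<m. c i * y i)" for y
    unfolding 1[of y, symmetric] by (subst sum.swap) (simp add: sym[of _ _] mult_ac)
  have "(\<Sum>i<m. \<Sum>j<m. M i j * (x i + s * u i) * (x j + s * u j)) =
    (\<Sum>i<m. \<Sum>j<m. M i j * x i * x j + s * (M i j * x i * u j) + s * (M i j * u i * x j)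
      + s\<^sup>2 * (M i j * u i * u j))"
    by (intro sum.cong refl) (simp add: algebra_simps power2_eq_square)
  also have "\<dots> = (\<Sum>i<m. \<Sum>j<m. M i j * x i * x j) + s * (\<Sum>i<m. \<Sum>j<m. M i j * x i * u j)
      + s * (\<Sum>i<m. \<Sum>j<m. M i j * u i * x j) + s\<^sup>2 * (\<Sum>i<m. \<Sum>j<m. M i j * u i * u j)"
    by (simp add: sum.distrib sum_distrib_left)
  finally show ?thesis by (simp add: 1 2)
qed

text \<open>Completing the square: the bordered form at (x, s) is the form of \<open>M\<close> at x
  + s u plus s^2 times the Schur complement. A solution \<open>u\<close> of M u = c stands in for
  the inverse of \<open>M\<close> applied to c, so any description of that solution may be plugged
  in later.\<close>

lemma bordered_form_pos:
  fixes M :: "nat \<Rightarrow> nat \<Rightarrow> real"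
  assumes pos: "\<And>x. \<exists>i<m. x i \<noteq> 0 \<Longrightarrow> (\<Sum>i<m. \<Sum>j<m. M i j * x i * x j) > 0"
    and sym: "\<And>i j. M i j = M j i"
    and u: "\<And>i. i < m \<Longrightarrow> (\<Sum>j<m. M i j * u j) = c i"
    and a: "a > (\<Sum>i<m. c i * u i)"
    and nz: "s \<noteq> 0 \<or> (\<exists>i<m. x i \<noteq> 0)"
  shows "(\<Sum>i<m. \<Sum>j<m. M i j * x i * x j) + 2 * s * (\<Sum>i<m. c i * x i) + a * s\<^sup>2 > 0"
proof -
  let ?y = "\<lambda>i. x i + s * u i"
  have nonneg: "(\<Sum>i<m. \<Sum>j<m. M i j * y i * y j) \<ge> 0" for y
  proof (cases "\<exists>i<m. y i \<noteq> 0")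
    case True
    then show ?thesis using pos[of y] by simp
  qed (simp add: sum.neutral)
  have eq: "(\<Sum>i<m. \<Sum>j<m. M i j * x i * x j) + 2 * s * (\<Sum>i<m. c i * x i) + a * s\<^sup>2 =
      (\<Sum>i<m. \<Sum>j<m. M i j * ?y i * ?y j) + s\<^sup>2 * (a - (\<Sum>i<m. c i * u i))"
    by (subst sum_complete_square[where M = M and u = u and c = c, OF sym u]) (simp_all add: algebra_simps)
  show ?thesis
  proof (cases "s = 0")
    case True
    then show ?thesis using nz pos[of x] by simp
  next
    case False
    then have "s\<^sup>2 * (a - (\<Sum>i<m. c i * u i)) > 0" using a by simp
    then show ?thesis using nonneg[of ?y] unfolding eq by linarith
  qed
qed

lemma hankel_pos_extend_back:
  assumes "hankel_pos g lo m"
    and "\<And>i. i < m \<Longrightarrow> (\<Sum>j<m. g (lo + int i + int j) * u j) = g (lo + int m + int i)"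
    and "g (lo + 2 * int m) > (\<Sum>i<m. g (lo + int m + int i) * u i)"
  shows "hankel_pos g lo (Suc m)"
  unfolding hankel_pos_def
proof (intro allI impI)
  fix x :: "nat \<Rightarrow> real" assume "\<exists>i<Suc m. x i \<noteq> 0"
  then have nz: "x m \<noteq> 0 \<or> (\<exists>i<m. x i \<noteq> 0)" by (auto simp: less_Suc_eq)
  have "(\<Sum>i<Suc m. \<Sum>j<Suc m. g (lo + int i + int j) * x i * x j) =
    (\<Sum>i<m. \<Sum>j<m. g (lo + int i + int j) * x i * x j)
      + 2 * x m * (\<Sum>i<m. g (lo + int m + int i) * x i) + g (lo + 2 * int m) * (x m)\<^sup>2"
    by (simp add: sum.distrib sum_distrib_left power2_eq_square algebra_simps)
  also have "\<dots> > 0"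
    using assms nz by (intro bordered_form_pos[where u = u]) (simp_all add: hankel_pos_def add_ac)
  finally show "(\<Sum>i<Suc m. \<Sum>j<Suc m. g (lo + int i + int j) * x i * x j) > 0" .
qed

text \<open>Dropping the first row and column of a Hankel matrix raises its starting index by 2, and
  the rest of the dropped row starts at \<open>lo + 1\<close>.\<close>

lemma hankel_pos_extend_front:
  assumes "hankel_pos g (lo + 2) m"
    and "\<And>i. i < m \<Longrightarrow> (\<Sum>j<m. g (lo + 2 + int i + int j) * u j) = g (lo + 1 + int i)"
    and "g lo > (\<Sum>i<m. g (lo + 1 + int i) * u i)"
  shows "hankel_pos g lo (Suc m)"
  unfolding hankel_pos_def
proof (intro allI impI)
  fix x :: "nat \<Rightarrow> real" assume "\<exists>i<Suc m. x i \<noteq> 0"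
  then have nz: "x 0 \<noteq> 0 \<or> (\<exists>i<m. x (Suc i) \<noteq> 0)" using less_Suc_eq_0_disj by auto
  have "(\<Sum>i<Suc m. \<Sum>j<Suc m. g (lo + int i + int j) * x i * x j) =
    (\<Sum>i<m. \<Sum>j<m. g (lo + 2 + int i + int j) * x (Suc i) * x (Suc j))
      + 2 * x 0 * (\<Sum>i<m. g (lo + 1 + int i) * x (Suc i)) + g lo * (x 0)\<^sup>2"
    by (simp add: sum.lessThan_Suc_shift sum.distrib sum_distrib_left power2_eq_square algebra_simps
        del: sum.lessThan_Suc)
  also have "\<dots> > 0"
    using assms nz
    by (intro bordered_form_pos[where u = u and x = "\<lambda>i. x (Suc i)"]) (simp_all add: hankel_pos_def add_ac)
  finally show "(\<Sum>i<Suc m. \<Sum>j<Suc m. g (lo + int i + int j) * x i * x j) > 0" .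
qed

section \<open>Inverses of positive definite matrices and block inversion\<close>

lemma pos_def_mat_inv:
  assumes A: "A \<in> carrier_mat m m" and pd: "pos_def A"
  shows "mat_inv A \<in> carrier_mat m m" "A * mat_inv A = 1\<^sub>m m" "mat_inv A * A = 1\<^sub>m m"
proof -
  have "Determinant.det A \<noteq> 0"
  proof
    assume "Determinant.det A = 0"
    then obtain x where "x \<in> carrier_vec m" "x \<noteq> 0\<^sub>v m" "A *\<^sub>v x = 0\<^sub>v m"
      using det_0_iff_vec_prod_zero[OF A] by blast
    then show False using pd A unfolding pos_def_def by force
  qed
  then have "A \<in> Units (ring_mat TYPE(real) m ())" by (rule det_non_zero_imp_unit[OF A])
  then obtain B where "mat_inverse A = Some B"
    using mat_inverse(1)[OF A, of "()"] by (cases "mat_inverse A") auto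
  then show "mat_inv A \<in> carrier_mat m m" "A * mat_inv A = 1\<^sub>m m" "mat_inv A * A = 1\<^sub>m m"
    using mat_inverse(2)[OF A, of B] by (simp_all add: mat_inv_def)
qed

lemma pos_def_mult_mat_inv_vec:
  assumes "A \<in> carrier_mat m m" "pos_def A" "v \<in> carrier_vec m"
  shows "A *\<^sub>v (mat_inv A *\<^sub>v v) = v"
proof -
  have "A *\<^sub>v (mat_inv A *\<^sub>v v) = (A * mat_inv A) *\<^sub>v v"
    using assms pos_def_mat_inv(1)[OF assms(1,2)] by (simp add: assoc_mult_mat_vec)
  then show ?thesis using pos_def_mat_inv(2)[OF assms(1,2)] assms(3) by simp
qed

lemma pos_def_mat_inv_symmetric:
  assumes A: "A \<in> carrier_mat m m" and pd: "pos_def A"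
    and v: "v \<in> carrier_vec m" and w: "w \<in> carrier_vec m"
  shows "scalar_prod v (mat_inv A *\<^sub>v w) = scalar_prod w (mat_inv A *\<^sub>v v)"
proof -
  let ?x = "mat_inv A *\<^sub>v v" and ?y = "mat_inv A *\<^sub>v w"
  have xy: "?x \<in> carrier_vec m" "?y \<in> carrier_vec m"
    using pos_def_mat_inv(1)[OF A pd] v w by (auto intro: mult_mat_vec_carrier)
  have T: "transpose_mat A = A" using pd by (simp add: pos_def_def)
  have "scalar_prod v ?y = scalar_prod (transpose_mat A *\<^sub>v ?x) ?y"
    by (simp only: T pos_def_mult_mat_inv_vec[OF A pd v])
  also have "\<dots> = scalar_prod ?x (A *\<^sub>v ?y)"
    by (rule transpose_vec_mult_scalar[OF A xy(2,1)])
  also have "\<dots> = scalar_prod ?x w" by (simp only: pos_def_mult_mat_inv_vec[OF A pd w])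
  also have "\<dots> = scalar_prod w ?x" using xy(1) w by (rule comm_scalar_prod)
  finally show ?thesis .
qed

lemma outer_mult_vec:
  assumes "c \<in> carrier_vec m" "x \<in> carrier_vec m"
  shows "outer c *\<^sub>v x = scalar_prod c x \<cdot>\<^sub>v c"
  using assms by (intro eq_vecI) (auto simp: outer_def scalar_prod_sum_lessThan sum_distrib_left
      sum_distrib_right mult_ac intro!: sum.cong)

text \<open>Block inversion: \<open>y\<close> and \<open>s\<close> solve the linear system of the matrix \<open>A\<close> bordered by \<open>c\<close>
  with corner \<open>a\<close> and right-hand side \<open>(v, t)\<close>.\<close>

lemma smult_mat_mult_vec:
  fixes c :: real
  assumes "A \<in> carrier_mat m k" "x \<in> carrier_vec k"
  shows "(c \<cdot>\<^sub>m A) *\<^sub>v x = c \<cdot>\<^sub>v (A *\<^sub>v x)"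
  by (rule eq_vecI) (use assms in \<open>auto simp: smult_scalar_prod_distrib[of _ k]\<close>)

lemma bordered_inverse:
  fixes a t :: real
  assumes A: "A \<in> carrier_mat m m" and pd: "pos_def A"
    and c: "c \<in> carrier_vec m" and v: "v \<in> carrier_vec m"
  defines "Ai \<equiv> mat_inv A"
  defines "w \<equiv> a - scalar_prod c (Ai *\<^sub>v c)"
  assumes w: "w \<noteq> 0"
  obtains y s where "y \<in> carrier_vec m" "A *\<^sub>v y + s \<cdot>\<^sub>v c = v" "scalar_prod c y + a * s = t"
    "scalar_prod v y + t * s =
       scalar_prod v ((Ai + (1 / w) \<cdot>\<^sub>m (Ai * outer c * Ai)) *\<^sub>v v)
       - 2 * t / w * scalar_prod v (Ai *\<^sub>v c) + t\<^sup>2 / w"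
proof -
  have Ai: "Ai \<in> carrier_mat m m" unfolding Ai_def by (rule pos_def_mat_inv(1)[OF A pd])
  have oc: "outer c \<in> carrier_mat m m" using c by (simp add: outer_def)
  \<comment> \<open>Eliminating \<open>y\<close> from the bordered system: the first block gives y =
    Ai v - s Ai c, and inserting this into the last equation leaves w s = t - c . Ai v.\<close>
  define s where "s = (t - scalar_prod c (Ai *\<^sub>v v)) / w"
  have Aic: "Ai *\<^sub>v c \<in> carrier_vec m" and Aiv: "Ai *\<^sub>v v \<in> carrier_vec m"
    using Ai c v by (auto intro: mult_mat_vec_carrier)
  define y where "y = Ai *\<^sub>v v - s \<cdot>\<^sub>v (Ai *\<^sub>v c)"
  have y: "y \<in> carrier_vec m" using Aic Aiv by (simp add: y_def)
  have prod_y: "scalar_prod x y = scalar_prod x (Ai *\<^sub>v v) - s * scalar_prod x (Ai *\<^sub>v c)"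
    if "x \<in> carrier_vec m" for x
    unfolding y_def using that Aic Aiv by (simp add: scalar_prod_minus_distrib)
  have "A *\<^sub>v y = A *\<^sub>v (Ai *\<^sub>v v) - A *\<^sub>v (s \<cdot>\<^sub>v (Ai *\<^sub>v c))"
    unfolding y_def using A Aic Aiv by (intro mult_minus_distrib_mat_vec) auto
  also have "A *\<^sub>v (s \<cdot>\<^sub>v (Ai *\<^sub>v c)) = s \<cdot>\<^sub>v (A *\<^sub>v (Ai *\<^sub>v c))"
    using A Aic by (intro mult_mat_vec)
  finally have "A *\<^sub>v y = v - s \<cdot>\<^sub>v c"
    by (simp only: Ai_def pos_def_mult_mat_inv_vec[OF A pd] c v)
  then have 1: "A *\<^sub>v y + s \<cdot>\<^sub>v c = v" using c v by (auto intro!: eq_vecI)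
  have ws: "w * s = t - scalar_prod c (Ai *\<^sub>v v)" using w by (simp add: s_def)
  then have 2: "scalar_prod c y + a * s = t"
    unfolding prod_y[OF c] w_def by (simp add: algebra_simps)
  have sym: "scalar_prod c (Ai *\<^sub>v v) = scalar_prod v (Ai *\<^sub>v c)"
    unfolding Ai_def by (rule pos_def_mat_inv_symmetric[OF A pd c v])
  have "(Ai + (1 / w) \<cdot>\<^sub>m (Ai * outer c * Ai)) *\<^sub>v v = Ai *\<^sub>v v + ((1 / w) \<cdot>\<^sub>m (Ai * outer c * Ai)) *\<^sub>v v"
    using Ai oc v by (intro add_mult_distrib_mat_vec) auto
  also have "((1 / w) \<cdot>\<^sub>m (Ai * outer c * Ai)) *\<^sub>v v = (1 / w) \<cdot>\<^sub>v ((Ai * outer c * Ai) *\<^sub>v v)"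
    using Ai oc v by (intro smult_mat_mult_vec) auto
  also have "(Ai * outer c * Ai) *\<^sub>v v = (Ai * outer c) *\<^sub>v (Ai *\<^sub>v v)"
    using Ai oc v by (intro assoc_mult_mat_vec) auto
  also have "\<dots> = Ai *\<^sub>v (outer c *\<^sub>v (Ai *\<^sub>v v))"
    using Ai oc Aiv by (intro assoc_mult_mat_vec) auto
  also have "\<dots> = scalar_prod c (Ai *\<^sub>v v) \<cdot>\<^sub>v (Ai *\<^sub>v c)"
    unfolding outer_mult_vec[OF c Aiv] using Ai c by (intro mult_mat_vec)
  finally have "scalar_prod v ((Ai + (1 / w) \<cdot>\<^sub>m (Ai * outer c * Ai)) *\<^sub>v v) =
      scalar_prod v (Ai *\<^sub>v v) + scalar_prod c (Ai *\<^sub>v v) / w * scalar_prod v (Ai *\<^sub>v c)"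
    using v Aic Aiv by (simp add: scalar_prod_add_distrib[of _ m])
  then have 3: "scalar_prod v y + t * s =
       scalar_prod v ((Ai + (1 / w) \<cdot>\<^sub>m (Ai * outer c * Ai)) *\<^sub>v v)
       - 2 * t / w * scalar_prod v (Ai *\<^sub>v c) + t\<^sup>2 / w"
    unfolding prod_y[OF v] s_def sym using w by (simp add: field_simps power2_eq_square)
  show thesis using that y 1 2 3 by blast
qed

text \<open>Its last equation is the form in which the hypotheses on \<open>t3\<close> and on the
  lowest entry of \<gamma> enter: their right-hand sides are products of (v, t) with the solution
  \<open>u\<close> of the Hankel system of size m + 1 whose right-hand side is again (v, t).\<close>

lemma hankel_bordered_inverse:
  fixes t :: real
  assumes pos: "hankel_pos g lo m" and v: "v \<in> carrier_vec m"
  defines "Ai \<equiv> mat_inv (hankel g lo m)" and "c \<equiv> segment g (lo + int m) m"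
  defines "w \<equiv> g (lo + 2 * int m) - scalar_prod c (Ai *\<^sub>v c)"
  assumes w: "w \<noteq> 0"
  obtains u where
    "\<And>i. i < m \<Longrightarrow> (\<Sum>j<Suc m. g (lo + int i + int j) * u j) = vec_index v i"
    "(\<Sum>j<Suc m. g (lo + int m + int j) * u j) = t"
    "(\<Sum>i<m. vec_index v i * u i) + t * u m =
       scalar_prod v ((Ai + (1 / w) \<cdot>\<^sub>m (Ai * outer c * Ai)) *\<^sub>v v)
       - 2 * t / w * scalar_prod v (Ai *\<^sub>v c) + t\<^sup>2 / w"
proof -
  have pd: "pos_def (hankel g lo m)" using pos by (simp add: pos_def_hankel_iff)
  have c: "c \<in> carrier_vec m" by (simp add: c_def)
  obtain y s where ys: "y \<in> carrier_vec m" "hankel g lo m *\<^sub>v y + s \<cdot>\<^sub>v c = v"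
    "scalar_prod c y + g (lo + 2 * int m) * s = t"
    "scalar_prod v y + t * s =
       scalar_prod v ((Ai + (1 / w) \<cdot>\<^sub>m (Ai * outer c * Ai)) *\<^sub>v v)
       - 2 * t / w * scalar_prod v (Ai *\<^sub>v c) + t\<^sup>2 / w"
    using bordered_inverse[OF hankel_carrier pd c v, of "g (lo + 2 * int m)" t] w
    unfolding Ai_def w_def by blast
  define u where "u j = (if j < m then vec_index y j else s)" for j
  have um: "u m = s" and uj: "\<And>j. j < m \<Longrightarrow> u j = vec_index y j" by (simp_all add: u_def)
  show thesis
  proof (rule that[of u])
    fix i assume i: "i < m"
    have "vec_index v i = vec_index (hankel g lo m *\<^sub>v y) i + s * g (lo + int m + int i)"
      using i c ys(1) unfolding ys(2)[symmetric] by (simp add: c_def del: index_mult_mat_vec)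
    then show "(\<Sum>j<Suc m. g (lo + int i + int j) * u j) = vec_index v i"
      using i ys(1) by (simp add: hankel_mult_vec_index um uj add_ac mult_ac del: index_mult_mat_vec)
  next
    show "(\<Sum>j<Suc m. g (lo + int m + int j) * u j) = t"
      using ys(1,3) by (simp add: um uj c_def scalar_prod_sum_lessThan add_ac mult_ac)
  next
    show "(\<Sum>i<m. vec_index v i * u i) + t * u m =
       scalar_prod v ((Ai + (1 / w) \<cdot>\<^sub>m (Ai * outer c * Ai)) *\<^sub>v v)
       - 2 * t / w * scalar_prod v (Ai *\<^sub>v c) + t\<^sup>2 / w"
      using ys(1,4) by (simp add: um uj scalar_prod_sum_lessThan)
  qed
qed

lemma hankel_inverse_solution:
  assumes pos: "hankel_pos g lo m" and v: "v \<in> carrier_vec m"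
  obtains u where "\<And>i. i < m \<Longrightarrow> (\<Sum>j<m. g (lo + int i + int j) * u j) = vec_index v i"
    "scalar_prod v (mat_inv (hankel g lo m) *\<^sub>v v) = (\<Sum>i<m. vec_index v i * u i)"
proof -
  have pd: "pos_def (hankel g lo m)" using pos by (simp add: pos_def_hankel_iff)
  let ?u = "mat_inv (hankel g lo m) *\<^sub>v v"
  have u: "?u \<in> carrier_vec m"
    using pos_def_mat_inv(1)[OF hankel_carrier pd] v by (rule mult_mat_vec_carrier)
  show thesis
  proof (rule that[of "vec_index ?u"])
    fix i assume "i < m"
    then show "(\<Sum>j<m. g (lo + int i + int j) * vec_index ?u j) = vec_index v i"
      using pos_def_mult_mat_inv_vec[OF hankel_carrier pd v] hankel_mult_vec_index[OF u] by metis
  qed (use carrier_vecD[OF u] in \<open>simp add: scalar_prod_sum_lessThan del: index_mult_mat_vec dim_mult_mat_vec\<close>)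
qed

text \<open>By symmetry both sides equal the bilinear form of \<open>M\<close> at u and v. This
  identifies a value computed by block inversion with the one computed from the inverse of the whole
  matrix.\<close>

lemma solution_form_unique:
  fixes M :: "nat \<Rightarrow> nat \<Rightarrow> real"
  assumes sym: "\<And>i j. M i j = M j i"
    and u: "\<And>i. i < m \<Longrightarrow> (\<Sum>j<m. M i j * u j) = c i"
    and v: "\<And>i. i < m \<Longrightarrow> (\<Sum>j<m. M i j * v j) = c i"
  shows "(\<Sum>i<m. c i * u i) = (\<Sum>i<m. c i * v i)"
proof -
  have "(\<Sum>i<m. c i * u i) = (\<Sum>i<m. \<Sum>j<m. M i j * v j * u i)"
    using v by (intro sum.cong) (simp_all flip: sum_distrib_right)
  also have "\<dots> = (\<Sum>j<m. \<Sum>i<m. M j i * u i * v j)"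
    by (subst sum.swap) (simp add: sym[of _ _] mult_ac)
  also have "\<dots> = (\<Sum>j<m. c j * v j)"
    using u by (intro sum.cong) (simp_all flip: sum_distrib_right)
  finally show ?thesis .
qed

section \<open>Vanishing of a bordered Hankel determinant\<close>

lemma det_hankel_eq_0_iff:
  "Determinant.det (hankel g lo m) = 0 \<longleftrightarrow>
    (\<exists>x. (\<exists>i<m. x i \<noteq> 0) \<and> (\<forall>i<m. (\<Sum>j<m. g (lo + int i + int j) * x j) = 0))"
proof -
  have eq: "hankel g lo m *\<^sub>v x = 0\<^sub>v m \<longleftrightarrow> (\<forall>i<m. (\<Sum>j<m. g (lo + int i + int j) * vec_index x j) = 0)"
    if "x \<in> carrier_vec m" for x
    using that by (auto simp: vec_eq_iff hankel_mult_vec_index simp del: index_mult_mat_vec)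
  show ?thesis
    unfolding det_0_iff_vec_prod_zero[OF hankel_carrier]
  proof (intro iffI; elim exE conjE)
    fix x :: "real Matrix.vec"
    assume x: "x \<in> carrier_vec m" "x \<noteq> 0\<^sub>v m" "hankel g lo m *\<^sub>v x = 0\<^sub>v m"
    then show "\<exists>x. (\<exists>i<m. x i \<noteq> 0) \<and> (\<forall>i<m. (\<Sum>j<m. g (lo + int i + int j) * x j) = 0)"
      using eq[OF x(1)] by (intro exI[of _ "vec_index x"]) (auto simp: vec_eq_iff)
  next
    fix x :: "nat \<Rightarrow> real" and i
    assume "i < m" "x i \<noteq> 0" "\<forall>i<m. (\<Sum>j<m. g (lo + int i + int j) * x j) = 0"
    then show "\<exists>v. v \<in> carrier_vec m \<and> v \<noteq> 0\<^sub>v m \<and> hankel g lo m *\<^sub>v v = 0\<^sub>v m"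
      using eq[of "Matrix.vec m x"]
      by (intro exI[of _ "Matrix.vec m x"]) (auto simp: vec_eq_iff simp del: index_mult_mat_vec)
  qed
qed

text \<open>Comparing kernels replaces the factorization of the determinant, since only its zeros
  are prescribed. With u solving the unbordered system for c, a kernel vector x has first
  coordinates - x_m u, and its last equation reads x_m w = 0.\<close>

lemma det_hankel_Suc_eq_0_iff:
  assumes pos: "hankel_pos g lo m"
  defines "c \<equiv> segment g (lo + int m) m"
  shows "Determinant.det (hankel g lo (Suc m)) = 0 \<longleftrightarrow>
    g (lo + 2 * int m) - scalar_prod c (mat_inv (hankel g lo m) *\<^sub>v c) = 0"
proof -
  obtain u where u: "\<And>i. i < m \<Longrightarrow> (\<Sum>j<m. g (lo + int i + int j) * u j) = vec_index c i"
    and form: "scalar_prod c (mat_inv (hankel g lo m) *\<^sub>v c) = (\<Sum>i<m. vec_index c i * u i)"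
    using hankel_inverse_solution[OF pos, of c] by (auto simp: c_def)
  have ci: "\<And>i. i < m \<Longrightarrow> vec_index c i = g (lo + int m + int i)" by (simp add: c_def)
  define w where "w = g (lo + 2 * int m) - (\<Sum>i<m. g (lo + int m + int i) * u i)"
  have u': "(\<Sum>j<m. g (lo + int i + int j) * u j) = g (lo + int m + int i)" if "i < m" for i
    using u[OF that] ci[OF that] by simp
  have "Determinant.det (hankel g lo (Suc m)) = 0 \<longleftrightarrow> w = 0"
    unfolding det_hankel_eq_0_iff
  proof (intro iffI; (elim exE conjE)?)
    fix x i assume nz: "i < Suc m" "x i \<noteq> 0"
      and "\<forall>i<Suc m. (\<Sum>j<Suc m. g (lo + int i + int j) * x j) = 0"
    then have z: "(\<Sum>j<m. g (lo + int i + int j) * x j) + g (lo + int i + int m) * x m = 0"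
      if "i \<le> m" for i using that by (simp add: less_Suc_eq_le)
    \<comment> \<open>This combination lies in the kernel of the unbordered matrix, so positivity
      makes it vanish.\<close>
    let ?y = "\<lambda>i. x i + x m * u i"
    have Ay: "(\<Sum>j<m. g (lo + int i + int j) * ?y j) = 0" if "i < m" for i
    proof -
      have "(\<Sum>j<m. g (lo + int i + int j) * ?y j) =
          (\<Sum>j<m. g (lo + int i + int j) * x j) + x m * (\<Sum>j<m. g (lo + int i + int j) * u j)"
        by (simp add: sum.distrib sum_distrib_left algebra_simps)
      then show ?thesis using z[of i] u'[OF that] that by (simp add: add_ac mult_ac)
    qed
    have "(\<Sum>i<m. \<Sum>j<m. g (lo + int i + int j) * ?y i * ?y j) =
        (\<Sum>i<m. ?y i * (\<Sum>j<m. g (lo + int i + int j) * ?y j))"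
      by (simp add: sum_distrib_left mult_ac)
    also have "\<dots> = 0" using Ay by (intro sum.neutral) simp
    finally have "\<not> (\<exists>i<m. ?y i \<noteq> 0)" using pos unfolding hankel_pos_def by fastforce
    then have x: "x i = - (x m * u i)" if "i < m" for i using that by (auto simp: add_eq_0_iff2)
    then have "x m \<noteq> 0" using nz by (auto simp: less_Suc_eq)
    moreover have "x m * w = 0"
    proof -
      have "(\<Sum>j<m. g (lo + int m + int j) * x j) = - (x m * (\<Sum>j<m. g (lo + int m + int j) * u j))"
        unfolding sum_distrib_left sum_negf[symmetric] by (intro sum.cong) (simp_all add: x)
      then show ?thesis using z[of m] by (simp add: w_def algebra_simps)
    qed
    ultimately show "w = 0" by simp
  next
    assume w: "w = 0"
    \<comment> \<open>The vector (u, -1): its first m equations hold for every w, and the last one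
      is w = 0.\<close>
    define x where "x i = (if i < m then u i else - 1)" for i
    have xm: "x m = - 1" and xi: "\<And>i. i < m \<Longrightarrow> x i = u i" by (simp_all add: x_def)
    have "(\<Sum>j<Suc m. g (lo + int i + int j) * x j) = 0" if "i < Suc m" for i
    proof (cases "i = m")
      case True
      then show ?thesis using w by (simp add: xm xi w_def add_ac)
    next
      case False
      then show ?thesis using that u'[of i] by (simp add: xm xi add_ac)
    qed
    then show "\<exists>x. (\<exists>i<Suc m. x i \<noteq> 0) \<and> (\<forall>i<Suc m. (\<Sum>j<Suc m. g (lo + int i + int j) * x j) = 0)"
      using xm by (intro exI[of _ x]) auto
  qed
  moreover have "(\<Sum>i<m. vec_index c i * u i) = (\<Sum>i<m. g (lo + int m + int i) * u i)"
    by (intro sum.cong) (simp_all add: ci)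
  ultimately show ?thesis unfolding form w_def by simp
qed

lemma hankel_pos_extend_back_inverse:
  assumes pos: "hankel_pos g lo m"
  defines "c \<equiv> segment g (lo + int m) m"
  assumes "g (lo + 2 * int m) - scalar_prod c (mat_inv (hankel g lo m) *\<^sub>v c) > 0"
  shows "hankel_pos g lo (Suc m)"
proof -
  obtain u where u: "\<And>i. i < m \<Longrightarrow> (\<Sum>j<m. g (lo + int i + int j) * u j) = vec_index c i"
    and form: "scalar_prod c (mat_inv (hankel g lo m) *\<^sub>v c) = (\<Sum>i<m. vec_index c i * u i)"
    using hankel_inverse_solution[OF pos, of c] by (auto simp: c_def)
  show ?thesis
    using assms(3) u unfolding form
    by (intro hankel_pos_extend_back[OF pos, of u]) (simp_all add: c_def)
qed

lemma hankel_pos_imp_positive_functional: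
  assumes "hankel_pos g lo (Suc m)"
  shows "positive_functional (\<lambda>k. g (lo + int k)) m"
  unfolding positive_functional_def
proof (intro allI impI)
  fix f :: "real poly" assume f: "Polynomial.degree f \<le> m" "f \<noteq> 0"
  let ?c = "Polynomial.coeff f"
  have rep: "(\<Sum>i\<le>m. Polynomial.monom (?c i) i) = f" using f(1) by (rule poly_as_sum_of_monoms')
  have "f * f = (\<Sum>i\<le>m. \<Sum>j\<le>m. Polynomial.monom (?c i * ?c j) (i + j))"
    by (subst (1 2) rep[symmetric]) (simp add: sum_product mult_monom)
  then have "moment_functional (\<lambda>k. g (lo + int k)) (f * f) =
      (\<Sum>i<Suc m. \<Sum>j<Suc m. g (lo + int i + int j) * ?c i * ?c j)"
    by (simp add: moment_functional_sum moment_functional_monom lessThan_Suc_atMost add_ac mult_ac)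
  moreover have "\<exists>i<Suc m. ?c i \<noteq> 0"
    using f by (intro exI[of _ "Polynomial.degree f"]) simp
  then have "(\<Sum>i<Suc m. \<Sum>j<Suc m. g (lo + int i + int j) * ?c i * ?c j) > 0"
    using assms unfolding hankel_pos_def by blast
  ultimately show "moment_functional (\<lambda>k. g (lo + int k)) (f * f) > 0" by simp
qed

section \<open>Moment identities for the Laurent moments\<close>

lemma sum_int_split_first: "a \<le> b \<Longrightarrow> sum f {a..b} = f a + sum f {a + 1..b}" for a b :: int
proof -
  assume "a \<le> b"
  then have "{a..b} = insert a {a + 1..b}" by auto
  then show ?thesis by simp
qed

lemma sum_int_split_last: "a \<le> b \<Longrightarrow> sum f {a..b} = sum f {a..b - 1} + f b" for a b :: int
proof -
  assume "a \<le> b"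
  then have "{a..b} = insert b {a..b - 1}" by auto
  then show ?thesis by (simp add: add.commute)
qed

section \<open>Coefficients of powers of a Laurent polynomial\<close>

lemma lcoef_0: "lcoef q 0 t = (if t = 0 then 1 else 0)"
  by (simp add: lcoef_def)

lemma fls_nth_const_X_intpow_mult:
  "fls_nth (fls_const c * fls_X_intpow i * f) t = c * fls_nth f (t - i)" for c :: real
  by (simp only: mult.assoc fls_X_intpow_times_conv_shift(1)) simp

lemma lcoef_Suc: "lcoef q (Suc j) t = (\<Sum>s\<le>4. q s * lcoef q j (t + 1 - int s))"
  unfolding lcoef_def power_Suc sum_distrib_right fls_nth_sum fls_nth_const_X_intpow_mult
  by (simp add: algebra_simps)

lemma lcoef_eq_0: "t < - int j \<or> t > 3 * int j \<Longrightarrow> lcoef q j t = 0"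
proof (induction j arbitrary: t)
  case 0
  then show ?case by (auto simp: lcoef_0)
next
  case (Suc j)
  show ?case unfolding lcoef_Suc
  proof (intro sum.neutral ballI)
    fix s :: nat assume "s \<in> {..4}"
    then have "lcoef q j (t + 1 - int s) = 0" using Suc.prems by (intro Suc.IH) auto
    then show "q s * lcoef q j (t + 1 - int s) = 0" by simp
  qed
qed

text \<open>In the recursion only s = 0 reaches the lowest exponent, as only s = 4 reaches the
  highest. These two extreme coefficients, nonzero by the assumptions on \<open>q\<close>, are what
  the equations for \<gamma> are solved by.\<close>

lemma lcoef_lowest: "lcoef q j (- int j) = q 0 ^ j"
proof (induction j)
  case (Suc j)
  have "(\<Sum>s\<le>4. q s * lcoef q j (- int (Suc j) + 1 - int s)) = (\<Sum>s\<in>{0}. q s * lcoef q j (- int j - int s))"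
    by (intro sum.mono_neutral_cong_right) (auto simp: lcoef_eq_0)
  then show ?case using Suc by (simp add: lcoef_Suc)
qed (simp add: lcoef_0)

lemma lcoef_highest: "lcoef q j (3 * int j) = q 4 ^ j"
proof (induction j)
  case (Suc j)
  have "(\<Sum>s\<le>4. q s * lcoef q j (3 * int (Suc j) + 1 - int s)) = (\<Sum>s\<in>{4}. q s * lcoef q j (3 * int j + 4 - int s))"
    by (intro sum.mono_neutral_cong_right) (auto intro!: lcoef_eq_0)
  then show ?case using Suc by (simp add: lcoef_Suc)
qed (simp add: lcoef_0)

lemma sum_lcoef_superset:
  assumes "a \<le> - int j" "3 * int j \<le> b"
  shows "(\<Sum>t = a..b. lcoef q j t * h t) = (\<Sum>t = - int j..3 * int j. lcoef q j t * h t)"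
  by (rule sum.mono_neutral_right) (use assms in \<open>auto simp: lcoef_eq_0\<close>)

text \<open>The y-coordinate of the curve point over x; at x = 0 the division yields the default 0,
  which is not on the curve.\<close>

definition branch :: "(nat \<Rightarrow> real) \<Rightarrow> real \<Rightarrow> real" where
  "branch q x = (\<Sum>s\<le>4. q s * x ^ s) / x"

lemma branch_power:
  assumes "x \<noteq> 0"
  shows "branch q x ^ j = (\<Sum>t = - int j..3 * int j. lcoef q j t * x powi t)"
proof (induction j)
  case 0
  show ?case by (simp add: lcoef_0)
next
  case (Suc j)
  have inner: "(\<Sum>t = - int (Suc j)..3 * int (Suc j). lcoef q j (t + 1 - int s) * x powi t) =
      x ^ s / x * branch q x ^ j" if "s \<le> 4" for s
  proof -
    \<comment> \<open>After the substitution u = t + 1 - s the range contains -j..3j for every s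
      \<le> 4, and the coefficients outside that interval vanish.\<close>
    have "(\<Sum>t = - int (Suc j)..3 * int (Suc j). lcoef q j (t + 1 - int s) * x powi t) =
        (\<Sum>u = - int (Suc j) + 1 - int s..3 * int (Suc j) + 1 - int s. lcoef q j u * x powi (u + int s - 1))"
      by (rule sum.reindex_bij_witness[of _ "\<lambda>u. u + int s - 1" "\<lambda>t. t + 1 - int s"]) auto
    also have "\<dots> = (\<Sum>u = - int j..3 * int j. lcoef q j u * x powi (u + int s - 1))"
      by (rule sum_lcoef_superset) (use that in auto)
    also have "\<dots> = (\<Sum>u = - int j..3 * int j. x ^ s / x * (lcoef q j u * x powi u))"
      using assms by (intro sum.cong) (auto simp: power_int_add power_int_diff)
    finally show ?thesis by (simp add: Suc sum_distrib_left)
  qed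
  have "(\<Sum>t = - int (Suc j)..3 * int (Suc j). lcoef q (Suc j) t * x powi t) =
      (\<Sum>s\<le>4. q s * (\<Sum>t = - int (Suc j)..3 * int (Suc j). lcoef q j (t + 1 - int s) * x powi t))"
    unfolding lcoef_Suc sum_distrib_left sum_distrib_right by (subst sum.swap) (simp add: mult.assoc)
  also have "\<dots> = (\<Sum>s\<le>4. q s * (x ^ s / x * branch q x ^ j))"
    by (intro sum.cong) (simp_all only: inner atMost_iff)
  also have "\<dots> = branch q x ^ Suc j"
    unfolding power_Suc mult.assoc[symmetric] sum_distrib_right[symmetric]
    by (simp add: branch_def sum_divide_distrib)
  finally show ?case ..
qed

section \<open>The equations satisfied by \<gamma>\<close>

lemma gamma_step_eqs:
  fixes q \<beta> n k g
  defines "h \<equiv> gamma_step q \<beta> n k g"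
  assumes q: "q 0 \<noteq> 0" "q 4 = 1" and k: "1 \<le> k" "k \<le> 2 * n - 2"
  shows "\<beta> 0 k = (\<Sum>t = - int k..3 * int k. lcoef q k t * h t)"
    and "\<beta> (2 * n - k - 1) k = (\<Sum>t = - int k..3 * int k. lcoef q k t * h (t + 2 * int n - int k - 1))"
    and "\<beta> (2 * n - k) k = (\<Sum>t = - int k..3 * int k. lcoef q k t * h (t + 2 * int n - int k))"
    and "\<And>i. i \<noteq> - int k \<Longrightarrow> i \<noteq> 2 * int n + 2 * int k - 1 \<Longrightarrow> i \<noteq> 2 * int n + 2 * int k \<Longrightarrow> h i = g i"
proof -
  define g1 where "g1 = g(- int k :=
    1 / q 0 ^ k * (\<beta> 0 k - (\<Sum>t = - int k + 1..3 * int k. lcoef q k t * g t)))"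
  define g2 where "g2 = g1(2 * int n + 2 * int k - 1 := \<beta> (2 * n - k - 1) k
    - (\<Sum>t = - int k..3 * int k - 1. lcoef q k t * g1 (t + 2 * int n - int k - 1)))"
  have h: "h = g2(2 * int n + 2 * int k := \<beta> (2 * n - k) k
    - (\<Sum>t = - int k..3 * int k - 1. lcoef q k t * g2 (t + 2 * int n - int k)))"
    unfolding h_def gamma_step_def g1_def g2_def Let_def by simp
  have high: "lcoef q k (3 * int k) = 1" using q by (simp add: lcoef_highest)
  show "h i = g i" if "i \<noteq> - int k" "i \<noteq> 2 * int n + 2 * int k - 1" "i \<noteq> 2 * int n + 2 * int k" for i
    using that by (simp add: h g1_def g2_def)
  have "h (- int k) = g1 (- int k)" using k by (simp add: h g2_def)
  then have "q 0 ^ k * h (- int k) = \<beta> 0 k - (\<Sum>t = - int k + 1..3 * int k. lcoef q k t * g t)"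
    using q by (simp add: g1_def)
  \<comment> \<open>The bound \<open>k \<le> 2 * n - 2\<close> gives 3k < 2n + 2k - 1, so none of
    the three writes of this step falls into the range of this sum.\<close>
  also have "(\<Sum>t = - int k + 1..3 * int k. lcoef q k t * g t) =
      (\<Sum>t = - int k + 1..3 * int k. lcoef q k t * h t)"
    using k by (intro sum.cong) (auto simp: h g2_def g1_def)
  finally show "\<beta> 0 k = (\<Sum>t = - int k..3 * int k. lcoef q k t * h t)"
    by (subst sum_int_split_first) (simp_all add: lcoef_lowest)
  have "h (2 * int n + 2 * int k - 1) = g2 (2 * int n + 2 * int k - 1)" by (simp add: h)
  \<comment> \<open>The indices read here end at 2n + 2k - 2, just below the two top entries still
    to be written.\<close>
  also have "\<dots> = \<beta> (2 * n - k - 1) k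
    - (\<Sum>t = - int k..3 * int k - 1. lcoef q k t * h (t + 2 * int n - int k - 1))"
    unfolding g2_def h by (auto intro!: sum.cong)
  finally show "\<beta> (2 * n - k - 1) k = (\<Sum>t = - int k..3 * int k. lcoef q k t * h (t + 2 * int n - int k - 1))"
    using high by (subst sum_int_split_last) (simp_all add: algebra_simps)
  have "h (2 * int n + 2 * int k) = \<beta> (2 * n - k) k
    - (\<Sum>t = - int k..3 * int k - 1. lcoef q k t * h (t + 2 * int n - int k))"
    unfolding h by (auto intro!: sum.cong)
  then show "\<beta> (2 * n - k) k = (\<Sum>t = - int k..3 * int k. lcoef q k t * h (t + 2 * int n - int k))"
    using high by (subst sum_int_split_last) (simp_all add: algebra_simps)
qed

lemma gamma_stage_stable:
  assumes q: "q 0 \<noteq> 0" "q 4 = 1" and "k \<le> K" "K \<le> 2 * n - 2"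
    and "- int k \<le> i" "i \<le> 2 * int n + 2 * int k"
  shows "gamma_stage q \<beta> n K i = gamma_stage q \<beta> n k i"
  using assms(3,4)
proof (induction K rule: dec_induct)
  case (step K)
  have "gamma_stage q \<beta> n (Suc K) i = gamma_stage q \<beta> n K i"
    unfolding gamma_stage.simps
    by (rule gamma_step_eqs(4)[OF q]) (use step assms in auto)
  then show ?case using step by simp
qed simp

lemma gamma1_eq_core:
  assumes "i \<noteq> 6 * int n - 3" "i \<noteq> - 2 * int n + 1" "i \<noteq> 6 * int n - 2"
  shows "gamma1 q \<beta> n t1 i = gamma_core q \<beta> n i"
  using assms by (simp add: gamma1_def Let_def)

lemma gamma1_t1:
  assumes "n \<ge> 1"
  shows "gamma1 q \<beta> n t1 (6 * int n - 3) = t1"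
  using assms by (simp add: gamma1_def Let_def)

text \<open>For k = 2n - 1 the equation of column 0 runs up to index 3k = 6n - 3, one past the end
  of the core; this is why \<open>t1\<close> is inserted before the equation is solved.\<close>

lemma gamma1_eqs:
  fixes q \<beta> n t1
  defines "h \<equiv> gamma1 q \<beta> n t1"
  assumes q: "q 0 \<noteq> 0" "q 4 = 1" and n: "n \<ge> 1"
  shows "\<beta> 0 (2 * n - 1) = (\<Sum>t = - 2 * int n + 1..6 * int n - 3. lcoef q (2 * n - 1) t * h t)"
    and "\<beta> 1 (2 * n - 1) = (\<Sum>t = - 2 * int n + 1..6 * int n - 3. lcoef q (2 * n - 1) t * h (t + 1))"
proof -
  define g1 where "g1 = (gamma_core q \<beta> n)(6 * int n - 3 := t1)"
  define g2 where "g2 = g1(- 2 * int n + 1 :=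
    1 / q 0 ^ (2 * n - 1) * (\<beta> 0 (2 * n - 1)
    - (\<Sum>t = - 2 * int n + 2..6 * int n - 3. lcoef q (2 * n - 1) t * g1 t)))"
  have h: "h = g2(6 * int n - 2 := \<beta> 1 (2 * n - 1)
    - (\<Sum>t = - 2 * int n + 1..6 * int n - 4. lcoef q (2 * n - 1) t * g2 (t + 1)))"
    unfolding h_def gamma1_def g1_def g2_def Let_def by simp
  have k: "- 2 * int n + 1 = - int (2 * n - 1)" "6 * int n - 3 = 3 * int (2 * n - 1)"
    using n by auto
  have low: "lcoef q (2 * n - 1) (- 2 * int n + 1) = q 0 ^ (2 * n - 1)"
    unfolding k by (rule lcoef_lowest)
  have high: "lcoef q (2 * n - 1) (6 * int n - 3) = 1"
    unfolding k lcoef_highest using q by simp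
  have "h (- 2 * int n + 1) = g2 (- 2 * int n + 1)" using n by (simp add: h)
  then have "q 0 ^ (2 * n - 1) * h (- 2 * int n + 1) = \<beta> 0 (2 * n - 1)
      - (\<Sum>t = - 2 * int n + 2..6 * int n - 3. lcoef q (2 * n - 1) t * g1 t)"
    using q by (simp add: g2_def)
  also have "(\<Sum>t = - 2 * int n + 2..6 * int n - 3. lcoef q (2 * n - 1) t * g1 t) =
      (\<Sum>t = - 2 * int n + 2..6 * int n - 3. lcoef q (2 * n - 1) t * h t)"
    by (intro sum.cong) (auto simp: h g2_def)
  finally show "\<beta> 0 (2 * n - 1) = (\<Sum>t = - 2 * int n + 1..6 * int n - 3. lcoef q (2 * n - 1) t * h t)"
    using n low by (subst sum_int_split_first) (simp_all add: add.commute)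
  have "h (6 * int n - 2) = \<beta> 1 (2 * n - 1)
    - (\<Sum>t = - 2 * int n + 1..6 * int n - 4. lcoef q (2 * n - 1) t * h (t + 1))"
    unfolding h by (auto intro!: sum.cong)
  then show "\<beta> 1 (2 * n - 1) = (\<Sum>t = - 2 * int n + 1..6 * int n - 3. lcoef q (2 * n - 1) t * h (t + 1))"
    using n high by (subst sum_int_split_last) simp_all
qed

text \<open>The sum defining this entry reads indices from -2n + 2 on and so misses the other entry
  that depends on \<open>t1\<close>, at -2n + 1. Only its last term, reading index 6n - 3, involves
  \<open>t1\<close>.\<close>

lemma gamma1_last_affine:
  assumes "n \<ge> 1"
  obtains a b where "\<And>t1. gamma1 q \<beta> n t1 (6 * int n - 2) = a + b * t1"
proof -
  let ?c = "gamma_core q \<beta> n"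
  have "gamma1 q \<beta> n t1 (6 * int n - 2) =
    (\<beta> 1 (2 * n - 1) - (\<Sum>t = - 2 * int n + 1..6 * int n - 5. lcoef q (2 * n - 1) t * ?c (t + 1)))
      + (- lcoef q (2 * n - 1) (6 * int n - 4)) * t1" for t1
  proof -
    define g2 where "g2 = gamma1 q \<beta> n t1"
    have "gamma1 q \<beta> n t1 (6 * int n - 2) = \<beta> 1 (2 * n - 1)
      - (\<Sum>t = - 2 * int n + 1..6 * int n - 4. lcoef q (2 * n - 1) t * g2 (t + 1))"
      unfolding g2_def gamma1_def Let_def by (auto intro!: sum.cong)
    also have "(\<Sum>t = - 2 * int n + 1..6 * int n - 4. lcoef q (2 * n - 1) t * g2 (t + 1)) =
      (\<Sum>t = - 2 * int n + 1..6 * int n - 5. lcoef q (2 * n - 1) t * g2 (t + 1))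
        + lcoef q (2 * n - 1) (6 * int n - 4) * t1"
      using assms gamma1_t1[OF assms, of q \<beta> t1] by (subst sum_int_split_last) (simp_all add: g2_def)
    also have "(\<Sum>t = - 2 * int n + 1..6 * int n - 5. lcoef q (2 * n - 1) t * g2 (t + 1)) =
      (\<Sum>t = - 2 * int n + 1..6 * int n - 5. lcoef q (2 * n - 1) t * ?c (t + 1))"
      unfolding g2_def by (intro sum.cong) (auto simp: gamma1_eq_core)
    finally show ?thesis by simp
  qed
  then show thesis by (rule that)
qed

lemma gamma_eq_gamma1:
  assumes "i \<noteq> 6 * int n - 1" "i \<noteq> 6 * int n" "i \<noteq> - 2 * int n"
  shows "gamma q \<beta> n t1 t2 t3 i = gamma1 q \<beta> n t1 i"
  using assms by (simp add: gamma_def Let_def)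

lemma gamma_t2_t3:
  assumes "n \<ge> 1"
  shows "gamma q \<beta> n t1 t2 t3 (6 * int n - 1) = t2" "gamma q \<beta> n t1 t2 t3 (6 * int n) = t3"
  using assms by (simp_all add: gamma_def Let_def)

lemma gamma_eq_stage:
  assumes q: "q 0 \<noteq> 0" "q 4 = 1" and "k \<le> 2 * n - 2" "n \<ge> 1"
    and "- int k \<le> i" "i \<le> 2 * int n + 2 * int k"
  shows "gamma q \<beta> n t1 t2 t3 i = gamma_stage q \<beta> n k i"
proof -
  have "gamma q \<beta> n t1 t2 t3 i = gamma_core q \<beta> n i"
    using assms by (subst gamma_eq_gamma1; (subst gamma1_eq_core)?) auto
  also have "\<dots> = gamma_stage q \<beta> n k i"
    unfolding gamma_core_def using assms by (intro gamma_stage_stable) auto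
  finally show ?thesis .
qed

lemma gamma_row_0:
  assumes q: "q 0 \<noteq> 0" "q 4 = 1" and n: "n \<ge> 1" and i: "i \<le> 2 * n"
  shows "gamma q \<beta> n t1 t2 t3 (int i) = \<beta> i 0"
proof -
  have "gamma q \<beta> n t1 t2 t3 (int i) = gamma_stage q \<beta> n 0 (int i)"
    using q n i by (intro gamma_eq_stage) auto
  then show ?thesis using i by simp
qed

lemma gamma_column_0:
  assumes q: "q 0 \<noteq> 0" "q 4 = 1" and n: "n \<ge> 1" and k: "k \<le> 2 * n"
  shows "\<beta> 0 k = (\<Sum>t = - int k..3 * int k. lcoef q k t * gamma q \<beta> n t1 t2 t3 t)"
proof -
  let ?g = "gamma q \<beta> n t1 t2 t3"
  consider "k = 0" | "1 \<le> k" "k \<le> 2 * n - 2" | "k = 2 * n - 1" | "k = 2 * n" using k by linarith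
  then show ?thesis
  proof cases
    case 1
    have "?g 0 = gamma_stage q \<beta> n 0 0" using q n by (intro gamma_eq_stage) auto
    then show ?thesis using 1 by (simp add: lcoef_0)
  next
    case 2
    then obtain k' where k': "k = Suc k'" by (cases k) auto
    have "\<beta> 0 k = (\<Sum>t = - int k..3 * int k. lcoef q k t * gamma_stage q \<beta> n k t)"
      using gamma_step_eqs(1)[OF q 2] unfolding k' by simp
    also have "\<dots> = (\<Sum>t = - int k..3 * int k. lcoef q k t * ?g t)"
      using 2 n q by (intro sum.cong) (auto simp: gamma_eq_stage[of q k])
    finally show ?thesis .
  next
    case 3
    then have "- int k = - 2 * int n + 1" "3 * int k = 6 * int n - 3" using n by auto
    moreover have "(\<Sum>t = - 2 * int n + 1..6 * int n - 3. lcoef q (2 * n - 1) t * gamma1 q \<beta> n t1 t) =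
      (\<Sum>t = - 2 * int n + 1..6 * int n - 3. lcoef q (2 * n - 1) t * ?g t)"
      by (intro sum.cong) (auto simp: gamma_eq_gamma1)
    ultimately show ?thesis using gamma1_eqs(1)[OF q n] 3 by simp
  next
    case 4
    define g where "g = (gamma1 q \<beta> n t1)(6 * int n - 1 := t2, 6 * int n := t3)"
    have g: "?g = g(- 2 * int n := 1 / q 0 ^ (2 * n) * (\<beta> 0 (2 * n)
      - (\<Sum>t = - 2 * int n + 1..6 * int n. lcoef q (2 * n) t * g t)))"
      unfolding gamma_def g_def Let_def by simp
    have "q 0 ^ (2 * n) * ?g (- 2 * int n) = \<beta> 0 (2 * n)
      - (\<Sum>t = - 2 * int n + 1..6 * int n. lcoef q (2 * n) t * ?g t)"
      unfolding g using q by (auto intro!: sum.cong)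
    moreover have "lcoef q (2 * n) (- 2 * int n) = q 0 ^ (2 * n)"
      using lcoef_lowest[of q "2 * n"] by simp
    ultimately have "\<beta> 0 (2 * n) = (\<Sum>t = - 2 * int n..6 * int n. lcoef q (2 * n) t * ?g t)"
      by (subst sum_int_split_first) simp_all
    then show ?thesis using 4 by simp
  qed
qed

lemma gamma_antidiagonals:
  assumes q: "q 0 \<noteq> 0" "q 4 = 1" and n: "n \<ge> 1" and ij: "1 \<le> i" "i + j = 2 * n \<or> i + j + 1 = 2 * n"
  shows "\<beta> i j = (\<Sum>t = - int j..3 * int j. lcoef q j t * gamma q \<beta> n t1 t2 t3 (t + int i))"
proof -
  let ?g = "gamma q \<beta> n t1 t2 t3"
  \<comment> \<open>For \<open>i \<ge> 1\<close> the value j = 2n - 1 occurs only with i = 1, and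
    that entry fixes index 6n - 2.\<close>
  consider "j = 0" | "1 \<le> j" "j \<le> 2 * n - 2" | "i = 1" "j = 2 * n - 1" using ij by linarith
  then show ?thesis
  proof cases
    case 1
    then have "?g (int i) = \<beta> i 0" using ij by (intro gamma_row_0[OF q n]) auto
    then show ?thesis using 1 by (simp add: lcoef_0)
  next
    case 2
    then obtain j' where j': "j = Suc j'" by (cases j) auto
    have "\<beta> i j = (\<Sum>t = - int j..3 * int j. lcoef q j t * gamma_stage q \<beta> n j (t + int i))"
      using ij(2)
    proof
      assume s: "i + j = 2 * n"
      have "\<beta> (2 * n - j) j = (\<Sum>t = - int j..3 * int j. lcoef q j t * gamma_stage q \<beta> n j (t + 2 * int n - int j))"
        using gamma_step_eqs(3)[OF q 2] unfolding j' by simp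
      moreover have "2 * n - j = i" "\<And>t. t + 2 * int n - int j = t + int i" using s by auto
      ultimately show ?thesis by simp
    next
      assume s: "i + j + 1 = 2 * n"
      have "\<beta> (2 * n - j - 1) j = (\<Sum>t = - int j..3 * int j. lcoef q j t * gamma_stage q \<beta> n j (t + 2 * int n - int j - 1))"
        using gamma_step_eqs(2)[OF q 2] unfolding j' by simp
      moreover have "2 * n - j - 1 = i" "\<And>t. t + 2 * int n - int j - 1 = t + int i" using s by auto
      ultimately show ?thesis by simp
    qed
    also have "\<dots> = (\<Sum>t = - int j..3 * int j. lcoef q j t * ?g (t + int i))"
      using 2 n q ij by (intro sum.cong) (auto simp: gamma_eq_stage[of q j])
    finally show ?thesis .
  next
    case 3
    then have "- int j = - 2 * int n + 1" "3 * int j = 6 * int n - 3" using n by auto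
    moreover have "(\<Sum>t = - 2 * int n + 1..6 * int n - 3. lcoef q (2 * n - 1) t * gamma1 q \<beta> n t1 (t + 1)) =
      (\<Sum>t = - 2 * int n + 1..6 * int n - 3. lcoef q (2 * n - 1) t * ?g (t + 1))"
      by (intro sum.cong) (auto simp: gamma_eq_gamma1)
    ultimately show ?thesis using gamma1_eqs(2)[OF q n] 3 by simp
  qed
qed

section \<open>Column relations of the moment matrix\<close>

lemma curve_poly_mult_monom:
  "curve_poly q * Polynomial.monom (Polynomial.monom 1 a) b =
    Polynomial.monom (Polynomial.monom 1 (a + 1)) (b + 1)
    - (\<Sum>s\<le>4. Polynomial.monom (Polynomial.monom (q s) (a + s)) b)"
proof -
  have X: "varX = Polynomial.monom (Polynomial.monom 1 1) 0"
    by (simp add: varX_def monom_altdef)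
  have Y: "varY = Polynomial.monom (Polynomial.monom 1 0) 1"
    by (simp add: varY_def monom_altdef)
  have C: "const2 c = Polynomial.monom (Polynomial.monom c 0) 0" for c
    by (simp add: const2_def monom_0)
  have Xs: "varX ^ s = Polynomial.monom (Polynomial.monom 1 s) 0" for s
    by (induction s) (simp_all add: X mult_monom monom_0 one_pCons)
  show ?thesis
    unfolding curve_poly_def Xs C left_diff_distrib sum_distrib_right
    by (simp add: X Y mult_monom add.commute)
qed

lemma coeff2_monom:
  "coeff2 (Polynomial.monom (Polynomial.monom c a) b) i j = (if i = a \<and> j = b then c else 0)"
  by (simp add: coeff2_def)

lemma coeff2_diff: "coeff2 (f - g) i j = coeff2 f i j - coeff2 g i j"
  by (simp add: coeff2_def)

lemma coeff2_sum: "coeff2 (\<Sum>s\<in>S. f s) i j = (\<Sum>s\<in>S. coeff2 (f s) i j)"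
  by (simp add: coeff2_def Polynomial.coeff_sum)

lemma finite_exponents: "finite (exponents n)"
  by (rule finite_subset[of _ "{..n} \<times> {..n}"]) (auto simp: exponents_def)

lemma column_comb_monom:
  assumes "a + b \<le> n"
  shows "column_comb n \<beta> (Polynomial.monom (Polynomial.monom c a) b) r = c * \<beta> (fst r + a) (snd r + b)"
proof -
  have "column_comb n \<beta> (Polynomial.monom (Polynomial.monom c a) b) r =
      (\<Sum>e\<in>exponents n. if e = (a, b) then c * \<beta> (fst r + a) (snd r + b) else 0)"
    unfolding column_comb_def coeff2_monom moment_matrix_def
    by (intro sum.cong) (auto simp: prod_eq_iff)
  then show ?thesis using assms finite_exponents by (simp add: exponents_def)
qed

lemma column_comb_diff:
  "column_comb n \<beta> (f - g) r = column_comb n \<beta> f r - column_comb n \<beta> g r"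
  by (simp add: column_comb_def coeff2_diff left_diff_distrib sum_subtractf)

lemma column_comb_sum:
  "column_comb n \<beta> (\<Sum>s\<in>S. f s) r = (\<Sum>s\<in>S. column_comb n \<beta> (f s) r)"
  unfolding column_comb_def coeff2_sum sum_distrib_right by (rule sum.swap)

text \<open>Row (c, d) of the column relation given by p times x^a y^b, where (i, j) = (a + c, b +
  d). The degree of p limits a + b to n - 4, and c + d is at most n; together this allows every i +
  j up to 2n - 4.\<close>

lemma p_pure_recursion:
  assumes pure: "p_pure (curve_poly q) n \<beta>" and n: "n \<ge> 4" and ij: "i + j + 4 \<le> 2 * n"
  shows "\<beta> (i + 1) (j + 1) = (\<Sum>s\<le>4. q s * \<beta> (i + s) j)"
proof -
  \<comment> \<open>Powers of x, then of y, fill the column monomial up to degree n - 4; the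
    remainder goes into the row.\<close>
  obtain a b c d where ab: "i = a + c" "j = b + d" "a + b + 4 \<le> n" "c + d \<le> n"
  proof (cases "i + 4 \<le> n")
    case True
    show thesis
      by (rule that[of i 0 "min j (n - 4 - i)" "j - min j (n - 4 - i)"]) (use True ij in auto)
  next
    case False
    show thesis
      by (rule that[of "n - 4" "i - (n - 4)" 0 j]) (use False ij n in auto)
  qed
  let ?h = "Polynomial.monom (Polynomial.monom 1 a) b"
  have "deg2_le (curve_poly q * ?h) n"
    unfolding deg2_le_def curve_poly_mult_monom coeff2_diff coeff2_sum coeff2_monom
  proof (intro allI impI, rule ccontr)
    fix k l
    assume "(if k = a + 1 \<and> l = b + 1 then 1 else 0)
      - (\<Sum>s\<le>4. if k = a + s \<and> l = b then q s else 0) \<noteq> 0" "\<not> k + l \<le> n"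
    moreover from this(2) have "(\<Sum>s\<le>4. if k = a + s \<and> l = b then q s else 0) = 0"
      using ab(3) by (intro sum.neutral) auto
    ultimately show False using ab(3) by (simp split: if_splits)
  qed
  then have "column_relation n \<beta> (curve_poly q * ?h)"
    using pure unfolding p_pure_def by blast
  then have "column_comb n \<beta> (curve_poly q * ?h) (c, d) = 0"
    unfolding column_relation_def using ab(4) by (auto simp: exponents_def)
  moreover have "(\<Sum>s\<le>4. column_comb n \<beta> (Polynomial.monom (Polynomial.monom (q s) (a + s)) b) (c, d)) =
      (\<Sum>s\<le>4. q s * \<beta> (i + s) j)"
    using ab by (intro sum.cong) (auto simp: column_comb_monom add_ac)
  ultimately show ?thesis
    using ab(3) unfolding curve_poly_mult_monom column_comb_diff column_comb_sum
    by (simp add: column_comb_monom ab add_ac)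
qed

section \<open>The curve and finitely atomic measures on it\<close>

lemma zero_set_curve_poly:
  "zero_set (curve_poly q) = {(x, y). x * y = (\<Sum>s\<le>4. q s * x ^ s)}"
proof -
  have "poly2 (curve_poly q) x y = x * y - (\<Sum>s\<le>4. q s * x ^ s)" for x y
    by (simp add: poly2_def curve_poly_def varX_def varY_def const2_def poly_sum poly_power)
  then show ?thesis by (auto simp: zero_set_def)
qed

lemma closed_zero_set_curve_poly: "closed (zero_set (curve_poly q))"
  unfolding zero_set_curve_poly case_prod_beta
  by (intro closed_Collect_eq continuous_intros)

text \<open>The measure is the image under \<open>f\<close> of a weighted counting measure.
  Closedness of \<open>Z\<close> makes the complement an open null set, which no support point can
  lie in; finiteness of \<open>S\<close> gives integrability.\<close>

lemma atomic_representing_measure: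
  fixes f :: "real \<Rightarrow> real \<times> real" and w :: "real \<Rightarrow> real"
  assumes S: "finite S" and Z: "closed Z" "f ` S \<subseteq> Z"
    and w: "\<And>r. r \<in> S \<Longrightarrow> w r \<ge> 0"
    and \<beta>: "\<And>i j. i + j \<le> 2 * n \<Longrightarrow> \<beta> i j = (\<Sum>r\<in>S. w r * (fst (f r) ^ i * snd (f r) ^ j))"
  shows "\<exists>\<mu>. representing_measure Z n \<beta> \<mu>"
proof -
  define P where "P = point_measure S (\<lambda>r. ennreal (w r))"
  define \<mu> where "\<mu> = distr P borel f"
  have meas: "f \<in> measurable P borel"
    by (simp add: P_def measurable_def space_point_measure sets_point_measure)
  have "measure_supp \<mu> \<subseteq> Z"
  proof
    fix x assume x: "x \<in> measure_supp \<mu>"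
    show "x \<in> Z"
    proof (rule ccontr)
      assume "x \<notin> Z"
      then have "emeasure \<mu> (- Z) > 0"
        using x Z(1) unfolding measure_supp_def by (auto simp: open_Compl)
      moreover have "emeasure \<mu> (- Z) = emeasure P (f -` (- Z) \<inter> space P)"
        unfolding \<mu>_def using Z(1) by (intro emeasure_distr[OF meas]) auto
      moreover have "f -` (- Z) \<inter> space P = {}"
        using Z(2) by (auto simp: P_def space_point_measure)
      ultimately show False by simp
    qed
  qed
  moreover have "integrable \<mu> (\<lambda>(x, y). x ^ i * y ^ j) \<and> \<beta> i j = (LINT (x, y)|\<mu>. x ^ i * y ^ j)"
    if "i + j \<le> 2 * n" for i j
  proof
    have m: "(\<lambda>(x, y). x ^ i * y ^ j :: real) \<in> borel_measurable borel"
      unfolding case_prod_beta by (intro borel_measurable_continuous_onI continuous_intros)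
    show "integrable \<mu> (\<lambda>(x, y). x ^ i * y ^ j)"
      unfolding \<mu>_def integrable_distr_eq[OF meas m] unfolding P_def by (rule integrable_point_measure_finite[OF S])
    show "\<beta> i j = (LINT (x, y)|\<mu>. x ^ i * y ^ j)"
      unfolding \<mu>_def integral_distr[OF meas m] unfolding P_def
      by (subst lebesgue_integral_point_measure_finite[OF S w]) (simp_all add: \<beta>[OF that] case_prod_beta)
  qed
  ultimately show ?thesis
    unfolding representing_measure_def by (intro exI[of _ \<mu>]) (simp add: \<mu>_def)
qed

text \<open>The atoms obey the recursion of \<beta> because r times \<open>branch q r\<close> is
  \<Sum> q_s r^s. On the entries outside its reach, the equations for \<gamma> are linear in
  \<gamma>, so inserting power sums turns the coefficients \<open>lcoef\<close> into powers of
  \<open>branch\<close>.\<close>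

lemma moments_on_curve:
  assumes q: "q 0 \<noteq> 0" "q 4 = 1" and n: "n \<ge> 4"
    and pure: "p_pure (curve_poly q) n \<beta>"
    and S: "0 \<notin> S"
    and \<gamma>: "\<And>k. - 2 * int n \<le> k \<Longrightarrow> k \<le> 6 * int n \<Longrightarrow>
      gamma q \<beta> n t1 t2 t3 k = (\<Sum>r\<in>S. w r * r powi k)"
    and ij: "i + j \<le> 2 * n"
  shows "\<beta> i j = (\<Sum>r\<in>S. w r * (r ^ i * branch q r ^ j))"
proof -
  have n1: "n \<ge> 1" using n by simp
  have r0: "r \<noteq> 0" if "r \<in> S" for r using S that by auto
  \<comment> \<open>The condition i + j \<le> 2n keeps t + i between -2n and 6n, which is the whole
    range of \<gamma>.\<close>
  have L: "(\<Sum>t = - int j..3 * int j. lcoef q j t * gamma q \<beta> n t1 t2 t3 (t + int i)) =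
      (\<Sum>r\<in>S. w r * (r ^ i * branch q r ^ j))" if "i + j \<le> 2 * n" for i j
  proof -
    have "(\<Sum>t = - int j..3 * int j. lcoef q j t * gamma q \<beta> n t1 t2 t3 (t + int i)) =
        (\<Sum>t = - int j..3 * int j. \<Sum>r\<in>S. w r * (r ^ i * (lcoef q j t * r powi t)))"
      using that r0 by (intro sum.cong refl)
        (auto simp: \<gamma> sum_distrib_left power_int_add intro!: sum.cong)
    also have "\<dots> = (\<Sum>r\<in>S. w r * (r ^ i * branch q r ^ j))"
      by (subst sum.swap) (simp add: branch_power r0 sum_distrib_left cong: sum.cong)
    finally show ?thesis .
  qed
  show ?thesis
    using ij
  proof (induction j arbitrary: i)
    case 0
    have "\<beta> i 0 = gamma q \<beta> n t1 t2 t3 (int i)" using gamma_row_0[OF q n1, of i] 0 by simp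
    then show ?case using 0 by (simp add: \<gamma>)
  next
    case (Suc j)
    show ?case
    proof (cases i)
      case 0
      then show ?thesis
        using L[of 0 "Suc j"] gamma_column_0[OF q n1, of "Suc j" \<beta> t1 t2 t3] Suc.prems by simp
    next
      case i: (Suc i')
      show ?thesis
      proof (cases "i' + j + 4 \<le> 2 * n")
        case True
        have "\<beta> i (Suc j) = (\<Sum>s\<le>4. q s * \<beta> (i' + s) j)"
          using p_pure_recursion[OF pure n True] i by simp
        also have "\<dots> = (\<Sum>s\<le>4. q s * (\<Sum>r\<in>S. w r * (r ^ (i' + s) * branch q r ^ j)))"
          using True by (intro sum.cong refl) (simp add: Suc.IH)
        also have "\<dots> = (\<Sum>r\<in>S. \<Sum>s\<le>4. q s * (w r * (r ^ (i' + s) * branch q r ^ j)))"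
          unfolding sum_distrib_left by (rule sum.swap)
        also have "\<dots> = (\<Sum>r\<in>S. w r * (r ^ i * branch q r ^ Suc j))"
        proof (intro sum.cong refl)
          fix r assume "r \<in> S"
          then have "r * branch q r = (\<Sum>s\<le>4. q s * r ^ s)" by (simp add: branch_def r0)
          then have "w r * (r ^ i * branch q r ^ Suc j) =
              w r * r ^ i' * branch q r ^ j * (\<Sum>s\<le>4. q s * r ^ s)"
            by (simp add: i flip: \<open>r * branch q r = _\<close>)
          also have "\<dots> = (\<Sum>s\<le>4. q s * (w r * (r ^ (i' + s) * branch q r ^ j)))"
            unfolding sum_distrib_left by (intro sum.cong) (simp_all add: power_add)
          finally show "(\<Sum>s\<le>4. q s * (w r * (r ^ (i' + s) * branch q r ^ j))) =
              w r * (r ^ i * branch q r ^ Suc j)" ..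
        qed
        finally show ?thesis .
      next
        case False
        \<comment> \<open>Failure of the degree condition of the recursion leaves exactly the total
          degrees 2n - 1 and 2n.\<close>
        then have "i + Suc j = 2 * n \<or> i + Suc j + 1 = 2 * n" "1 \<le> i" using Suc.prems i by auto
        then show ?thesis
          using gamma_antidiagonals[OF q n1, of i "Suc j" \<beta> t1 t2 t3] L[OF Suc.prems] by simp
      qed
    qed
  qed
qed

section \<open>Positivity of the extended Hankel matrix\<close>

lemma concave_quadratic_pos_between_roots:
  fixes a b c x y z :: real
  assumes "a < 0" "x < z" "z < y" "a * x\<^sup>2 + b * x + c = 0" "a * y\<^sup>2 + b * y + c = 0"
  shows "a * z\<^sup>2 + b * z + c > 0"
proof -
  have "(x - y) * (a * (x + y) + b) = (a * x\<^sup>2 + b * x + c) - (a * y\<^sup>2 + b * y + c)"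
    by (simp add: algebra_simps power2_eq_square)
  then have b: "b = - a * (x + y)" using assms by simp
  have "c = - a * x\<^sup>2 - b * x" using assms(4) by linarith
  then have c: "c = a * x * y" unfolding b by (simp add: algebra_simps power2_eq_square)
  have "a * z\<^sup>2 + b * z + c = - a * ((z - x) * (y - z))"
    unfolding b c by (simp add: algebra_simps power2_eq_square)
  moreover have "- a * ((z - x) * (y - z)) > 0"
    using assms by (intro mult_pos_pos) auto
  ultimately show ?thesis by simp
qed

lemma pos_def_mat_inv_form_affine:
  assumes A: "A \<in> carrier_mat m m" and pd: "pos_def A"
    and c: "c \<in> carrier_vec m" and e: "e \<in> carrier_vec m" "e \<noteq> 0\<^sub>v m"
  shows "scalar_prod (c + s \<cdot>\<^sub>v e) (mat_inv A *\<^sub>v (c + s \<cdot>\<^sub>v e)) =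
      scalar_prod c (mat_inv A *\<^sub>v c) + 2 * s * scalar_prod e (mat_inv A *\<^sub>v c)
        + s\<^sup>2 * scalar_prod e (mat_inv A *\<^sub>v e)"
    and "scalar_prod e (mat_inv A *\<^sub>v e) > 0"
proof -
  let ?Ai = "mat_inv A"
  have Ai: "?Ai \<in> carrier_mat m m" by (rule pos_def_mat_inv(1)[OF A pd])
  have Aic: "?Ai *\<^sub>v c \<in> carrier_vec m" and Aie: "?Ai *\<^sub>v e \<in> carrier_vec m"
    using Ai c e by (auto intro: mult_mat_vec_carrier)
  have "?Ai *\<^sub>v (c + s \<cdot>\<^sub>v e) = ?Ai *\<^sub>v c + s \<cdot>\<^sub>v (?Ai *\<^sub>v e)"
    using Ai c e by (simp add: mult_add_distrib_mat_vec[of _ m m] mult_mat_vec[of _ m m])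
  then have "scalar_prod (c + s \<cdot>\<^sub>v e) (?Ai *\<^sub>v (c + s \<cdot>\<^sub>v e)) =
      scalar_prod c (?Ai *\<^sub>v c) + s * scalar_prod c (?Ai *\<^sub>v e)
      + s * (scalar_prod e (?Ai *\<^sub>v c) + s * scalar_prod e (?Ai *\<^sub>v e))"
    using c e Aic Aie by (simp add: scalar_prod_add_distrib[of _ m] add_scalar_prod_distrib[of _ m] distrib_left)
  then show "scalar_prod (c + s \<cdot>\<^sub>v e) (?Ai *\<^sub>v (c + s \<cdot>\<^sub>v e)) =
      scalar_prod c (?Ai *\<^sub>v c) + 2 * s * scalar_prod e (?Ai *\<^sub>v c)
        + s\<^sup>2 * scalar_prod e (?Ai *\<^sub>v e)"
    using pos_def_mat_inv_symmetric[OF A pd c e(1)] by (simp add: algebra_simps power2_eq_square)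
  have AAie: "A *\<^sub>v (?Ai *\<^sub>v e) = e" by (rule pos_def_mult_mat_inv_vec[OF A pd e(1)])
  have "A *\<^sub>v 0\<^sub>v m = 0\<^sub>v m" using A by (intro eq_vecI) auto
  then have "?Ai *\<^sub>v e \<noteq> 0\<^sub>v m" using AAie e(2) by metis
  then have "scalar_prod (?Ai *\<^sub>v e) (A *\<^sub>v (?Ai *\<^sub>v e)) > 0"
    using pd Aie A unfolding pos_def_def by auto
  then show "scalar_prod e (?Ai *\<^sub>v e) > 0"
    unfolding AAie using comm_scalar_prod[OF e(1) Aie] by simp
qed

text \<open>The parameter \<open>t1\<close> enters c only in its last coordinate and the corner
  affinely, so the Schur complement is quadratic in \<open>t1\<close> with leading coefficient minus
  the last diagonal entry of the inverse of A, which is negative. It has the same zeros as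
  \<open>d_fun\<close>.\<close>

lemma schur_complement_pos_between_zeros:
  assumes n: "n \<ge> 1" and pd: "pos_def (A_gamma q \<beta> n)"
    and zeros: "{s. d_fun q \<beta> n s = 0} = {tm, tp}" and t1: "tm < t1" "t1 < tp"
  defines "c \<equiv> segment (gamma1 q \<beta> n t1) (2 * int n) (4 * n - 2)"
  shows "gamma1 q \<beta> n t1 (6 * int n - 2) - scalar_prod c (mat_inv (A_gamma q \<beta> n) *\<^sub>v c) > 0"
proof -
  let ?g = "gamma1 q \<beta> n"
  let ?A = "A_gamma q \<beta> n"
  let ?c = "\<lambda>s. segment (?g s) (2 * int n) (4 * n - 2)"
  let ?w = "\<lambda>s. ?g s (6 * int n - 2) - scalar_prod (?c s) (mat_inv ?A *\<^sub>v ?c s)"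
  have A: "?A = hankel (?g s) (- 2 * int n + 2) (4 * n - 2)" for s
    unfolding A_gamma_def using n by (intro hankel_cong) (auto simp: gamma1_eq_core)
  have idx: "- 2 * int n + 2 + int (4 * n - 2) = 2 * int n"
    "- 2 * int n + 2 + 2 * int (4 * n - 2) = 6 * int n - 2" "Suc (4 * n - 2) = 4 * n - 1"
    using n by auto
  have d: "d_fun q \<beta> n s = 0 \<longleftrightarrow> ?w s = 0" for s
  proof -
    have "hankel_pos (?g s) (- 2 * int n + 2) (4 * n - 2)"
      using pd unfolding A[of s] pos_def_hankel_iff .
    from det_hankel_Suc_eq_0_iff[OF this] show ?thesis
      unfolding idx d_fun_def F1_def A[of s] .
  qed
  \<comment> \<open>Coordinate 4n - 3 of the segment starting at 2n has index 6n - 3, the place of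
    \<open>t1\<close>.\<close>
  define e :: "real Matrix.vec" where "e = unit_vec (4 * n - 2) (4 * n - 3)"
  have e: "e \<in> carrier_vec (4 * n - 2)" "e \<noteq> 0\<^sub>v (4 * n - 2)"
    using n by (auto simp: e_def vec_eq_iff)
  have c: "?c s = ?c 0 + s \<cdot>\<^sub>v e" for s
  proof (rule eq_vecI)
    fix i assume "i < dim_vec (?c 0 + s \<cdot>\<^sub>v e)"
    then have i: "i < 4 * n - 2" by (simp add: e_def)
    show "vec_index (?c s) i = vec_index (?c 0 + s \<cdot>\<^sub>v e) i"
    proof (cases "i = 4 * n - 3")
      case True
      then have "2 * int n + int i = 6 * int n - 3" using n by auto
      then show ?thesis using i True gamma1_t1[OF n, of q \<beta>] by (simp add: e_def)
    next
      case False
      then have "2 * int n + int i < 6 * int n - 3" using i by auto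
      then show ?thesis using i False by (simp add: e_def gamma1_eq_core)
    qed
  qed (simp add: e_def)
  obtain a b where ab: "\<And>s. ?g s (6 * int n - 2) = a + b * s"
    using gamma1_last_affine[OF n] by blast
  have Ac: "?A \<in> carrier_mat (4 * n - 2) (4 * n - 2)" by (simp add: A_gamma_def)
  note form = pos_def_mat_inv_form_affine[OF Ac pd segment_carrier e]
  have w: "?w s = - scalar_prod e (mat_inv ?A *\<^sub>v e) * s\<^sup>2
      + (b - 2 * scalar_prod e (mat_inv ?A *\<^sub>v ?c 0)) * s
      + (a - scalar_prod (?c 0) (mat_inv ?A *\<^sub>v ?c 0))" for s
    by (subst c, subst (2) c, subst form(1)) (simp only: ab, simp add: algebra_simps)
  have "?w tm = 0" "?w tp = 0" using zeros unfolding d[symmetric] by auto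
  then have "?w t1 > 0"
    unfolding w using form(2) t1 by (intro concave_quadratic_pos_between_roots[of _ tm t1 tp]) auto
  then show ?thesis by (simp add: c_def)
qed

text \<open>The size grows from 4n - 2 to 4n at the back and to 4n + 1 at the front. Each of the
  last two borders is measured against the inverse of the previous matrix, itself written as a
  bordered one: A bordered by \<open>c1\<close> for the hypothesis on \<open>t3\<close>, and B
  bordered by \<open>c2\<close> with corner \<open>t3\<close> for the lowest entry.\<close>

lemma hankel_pos_gamma:
  fixes t2 t3 :: real
  assumes n: "n \<ge> 1" and pd: "pos_def (A_gamma q \<beta> n)"
    and zeros: "{s. d_fun q \<beta> n s = 0} = {tm, tp}" and t1: "tm < t1" "t1 < tp"
  defines "\<gamma> \<equiv> gamma q \<beta> n t1 t2 t3"
    and "Ai \<equiv> mat_inv (A_gamma q \<beta> n)"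
    and "Bi \<equiv> mat_inv (F1 q \<beta> n t1)"
  defines "c1 \<equiv> segment \<gamma> (2 * int n) (4 * n - 2)"
    and "v \<equiv> segment \<gamma> (2 * int n + 1) (4 * n - 2)"
    and "c2 \<equiv> segment \<gamma> (2 * int n + 1) (4 * n - 1)"
    and "z2 \<equiv> segment \<gamma> (- 2 * int n + 1) (4 * n - 1)"
  defines "w1 \<equiv> \<gamma> (6 * int n - 2) - scalar_prod c1 (Ai *\<^sub>v c1)"
    and "w2 \<equiv> t3 - scalar_prod c2 (Bi *\<^sub>v c2)"
  assumes t3: "t3 > scalar_prod v ((Ai + (1 / w1) \<cdot>\<^sub>m (Ai * outer c1 * Ai)) *\<^sub>v v)
              - 2 * t2 / w1 * scalar_prod v (Ai *\<^sub>v c1) + t2\<^sup>2 / w1"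
    and low: "\<gamma> (- 2 * int n) > scalar_prod z2 ((Bi + (1 / w2) \<cdot>\<^sub>m (Bi * outer c2 * Bi)) *\<^sub>v z2)
              - 2 * \<gamma> (2 * int n) / w2 * scalar_prod z2 (Bi *\<^sub>v c2) + (\<gamma> (2 * int n))\<^sup>2 / w2"
  shows "hankel_pos \<gamma> (- 2 * int n) (Suc (4 * n))"
proof -
  let ?lo = "- 2 * int n + 2"
  have A: "A_gamma q \<beta> n = hankel \<gamma> ?lo (4 * n - 2)"
    unfolding A_gamma_def \<gamma>_def using n
    by (intro hankel_cong) (auto simp: gamma1_eq_core gamma_eq_gamma1)
  have B: "F1 q \<beta> n t1 = hankel \<gamma> ?lo (4 * n - 1)"
    unfolding F1_def \<gamma>_def using n by (intro hankel_cong) (auto simp: gamma_eq_gamma1)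
  have c1: "c1 = segment (gamma1 q \<beta> n t1) (2 * int n) (4 * n - 2)"
    unfolding c1_def \<gamma>_def using n by (intro segment_cong) (auto simp: gamma_eq_gamma1)
  have idx: "?lo + int (4 * n - 2) = 2 * int n" "?lo + 2 * int (4 * n - 2) = 6 * int n - 2"
    "?lo + int (4 * n - 1) = 2 * int n + 1" "?lo + 2 * int (4 * n - 1) = 6 * int n"
    "Suc (4 * n - 2) = 4 * n - 1" "Suc (4 * n - 1) = 4 * n"
    using n by auto
  have gt: "\<gamma> (6 * int n - 1) = t2" "\<gamma> (6 * int n) = t3" unfolding \<gamma>_def using n by (rule gamma_t2_t3)+
  have "w1 > 0"
    using schur_complement_pos_between_zeros[OF n pd zeros t1] n
    unfolding w1_def c1 Ai_def by (simp add: \<gamma>_def gamma_eq_gamma1)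
  have pA: "hankel_pos \<gamma> ?lo (4 * n - 2)" using pd unfolding A pos_def_hankel_iff .
  have pB: "hankel_pos \<gamma> ?lo (4 * n - 1)"
    using hankel_pos_extend_back_inverse[OF pA] \<open>w1 > 0\<close>
    unfolding idx w1_def c1_def Ai_def A by simp
  have v: "v \<in> carrier_vec (4 * n - 2)" by (simp add: v_def)
  \<comment> \<open>\<open>u\<close> solves the system of B with right-hand side (v, t2), which is
    \<open>c2\<close>.\<close>
  obtain u where u: "\<And>i. i < 4 * n - 2 \<Longrightarrow>
      (\<Sum>j<4 * n - 1. \<gamma> (?lo + int i + int j) * u j) = vec_index v i"
    and u_last: "(\<Sum>j<4 * n - 1. \<gamma> (?lo + int (4 * n - 2) + int j) * u j) = t2"
    and u_eq: "(\<Sum>i<4 * n - 2. vec_index v i * u i) + t2 * u (4 * n - 2) =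
      scalar_prod v ((Ai + (1 / w1) \<cdot>\<^sub>m (Ai * outer c1 * Ai)) *\<^sub>v v)
      - 2 * t2 / w1 * scalar_prod v (Ai *\<^sub>v c1) + t2\<^sup>2 / w1"
    using hankel_bordered_inverse[OF pA v, of t2] less_imp_neq[OF \<open>w1 > 0\<close>, symmetric]
    unfolding idx w1_def c1_def Ai_def A by blast
  have u_form: "(\<Sum>i<4 * n - 2. vec_index v i * u i) + t2 * u (4 * n - 2) < t3"
    unfolding u_eq by (rule t3)
  have u2: "(\<Sum>j<4 * n - 1. \<gamma> (?lo + int i + int j) * u j) = \<gamma> (2 * int n + 1 + int i)"
    if i: "i < 4 * n - 1" for i
  proof (cases "i = 4 * n - 2")
    case True
    then have "2 * int n + 1 + int i = 6 * int n - 1" using n by auto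
    then show ?thesis using u_last True gt by simp
  next
    case False
    then show ?thesis using i u[of i] by (simp add: v_def)
  qed
  have "(\<Sum>i<4 * n - 1. \<gamma> (2 * int n + 1 + int i) * u i) < t3"
  proof -
    have "2 * int n + 1 + int (4 * n - 2) = 6 * int n - 1" using n by auto
    moreover have "(\<Sum>i<4 * n - 2. vec_index v i * u i) = (\<Sum>i<4 * n - 2. \<gamma> (2 * int n + 1 + int i) * u i)"
      by (intro sum.cong) (simp_all add: v_def)
    ultimately show ?thesis
      using u_form unfolding idx(5)[symmetric] sum.lessThan_Suc by (simp add: gt)
  qed
  note u_form2 = this
  have pG: "hankel_pos \<gamma> ?lo (4 * n)"
    using hankel_pos_extend_back[OF pB, of u] u2 u_form2 unfolding idx gt by simp
  have c2: "c2 \<in> carrier_vec (4 * n - 1)" and z2: "z2 \<in> carrier_vec (4 * n - 1)"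
    by (simp_all add: c2_def z2_def)
  obtain u' where u': "\<And>i. i < 4 * n - 1 \<Longrightarrow>
      (\<Sum>j<4 * n - 1. \<gamma> (?lo + int i + int j) * u' j) = vec_index c2 i"
    and u'_form: "scalar_prod c2 (Bi *\<^sub>v c2) = (\<Sum>i<4 * n - 1. vec_index c2 i * u' i)"
    using hankel_inverse_solution[OF pB c2] unfolding Bi_def B by blast
  \<comment> \<open>\<open>w2\<close> is defined by the inverse of B, whereas the hypothesis on
    \<open>t3\<close> spells out the same value by blocks of A; identifying the two turns that
    hypothesis into w2 > 0.\<close>
  have "(\<Sum>i<4 * n - 1. vec_index c2 i * u' i) = (\<Sum>i<4 * n - 1. vec_index c2 i * u i)"
    by (rule solution_form_unique[of "\<lambda>i j. \<gamma> (?lo + int i + int j)"])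
      (use u' u2 in \<open>simp_all add: c2_def add_ac\<close>)
  also have "\<dots> = (\<Sum>i<4 * n - 1. \<gamma> (2 * int n + 1 + int i) * u i)"
    by (intro sum.cong) (simp_all add: c2_def)
  finally have "w2 > 0" unfolding w2_def u'_form using u_form2 by simp
  then have w2: "\<gamma> (6 * int n) - scalar_prod c2 (Bi *\<^sub>v c2) > 0" by (simp add: w2_def gt)
  \<comment> \<open>The right-hand side (z2, \<gamma>_2n) is the segment of \<gamma> from -2n + 1 to
    2n, that is, the new first row without its corner.\<close>
  obtain x where x: "\<And>i. i < 4 * n - 1 \<Longrightarrow>
      (\<Sum>j<4 * n. \<gamma> (?lo + int i + int j) * x j) = vec_index z2 i"
    and x_last: "(\<Sum>j<4 * n. \<gamma> (?lo + int (4 * n - 1) + int j) * x j) = \<gamma> (2 * int n)"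
    and x_eq: "(\<Sum>i<4 * n - 1. vec_index z2 i * x i) + \<gamma> (2 * int n) * x (4 * n - 1) =
      scalar_prod z2 ((Bi + (1 / w2) \<cdot>\<^sub>m (Bi * outer c2 * Bi)) *\<^sub>v z2)
      - 2 * \<gamma> (2 * int n) / w2 * scalar_prod z2 (Bi *\<^sub>v c2) + (\<gamma> (2 * int n))\<^sup>2 / w2"
    using hankel_bordered_inverse[OF pB z2, of "\<gamma> (2 * int n)"] less_imp_neq[OF w2, symmetric]
    unfolding idx w2_def c2_def Bi_def B gt by blast
  have x_form: "(\<Sum>i<4 * n - 1. vec_index z2 i * x i) + \<gamma> (2 * int n) * x (4 * n - 1) < \<gamma> (- 2 * int n)"
    unfolding x_eq by (rule low)
  have x2: "(\<Sum>j<4 * n. \<gamma> (?lo + int i + int j) * x j) = \<gamma> (- 2 * int n + 1 + int i)"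
    if i: "i < 4 * n" for i
  proof (cases "i = 4 * n - 1")
    case True
    then have "- 2 * int n + 1 + int i = 2 * int n" using n by auto
    then show ?thesis using x_last True by simp
  next
    case False
    then show ?thesis using i x[of i] by (simp add: z2_def)
  qed
  have "(\<Sum>i<4 * n. \<gamma> (- 2 * int n + 1 + int i) * x i) < \<gamma> (- 2 * int n)"
  proof -
    have "- 2 * int n + 1 + int (4 * n - 1) = 2 * int n" using n by auto
    moreover have "(\<Sum>i<4 * n - 1. vec_index z2 i * x i) = (\<Sum>i<4 * n - 1. \<gamma> (- 2 * int n + 1 + int i) * x i)"
      by (intro sum.cong) (simp_all add: z2_def)
    ultimately show ?thesis
      using x_form sum.lessThan_Suc[of "\<lambda>i. \<gamma> (- 2 * int n + 1 + int i) * x i" "4 * n - 1"]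
      unfolding idx(6) by simp
  qed
  from hankel_pos_extend_front[OF pG x2 this] show ?thesis .
qed

theorem theorem4p1:
  fixes q :: "nat \<Rightarrow> real" and n :: nat and \<beta> :: "nat \<Rightarrow> nat \<Rightarrow> real"
  assumes "q 0 \<noteq> 0" and "q 4 = 1"
    and "n \<ge> 4"
    and "p_pure (curve_poly q) n \<beta>"
    and "\<beta> 0 0 > 0"
    and "pos_def (A_gamma q \<beta> n)"
    and "\<exists>t1 t2 t3.
      (\<exists>tm tp. tm \<le> tp \<and> {s. d_fun q \<beta> n s = 0} = {tm, tp} \<and> t1 \<in> {tm<..<tp}) \<and>
      (let
         \<gamma> = gamma q \<beta> n t1 t2 t3;
         Ai = mat_inv (A_gamma q \<beta> n);
         c1 = segment \<gamma> (2 * int n) (4 * n - 2);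
         w1 = \<gamma> (6 * int n - 2) - scalar_prod c1 (Ai *\<^sub>v c1);
         v = segment \<gamma> (2 * int n + 1) (4 * n - 2);
         Bi = mat_inv (F1 q \<beta> n t1);
         c2 = segment \<gamma> (2 * int n + 1) (4 * n - 1);
         w2 = t3 - scalar_prod c2 (Bi *\<^sub>v c2);
         z2 = segment \<gamma> (- 2 * int n + 1) (4 * n - 1)
       in
         t3 > scalar_prod v ((Ai + (1 / w1) \<cdot>\<^sub>m (Ai * outer c1 * Ai)) *\<^sub>v v)
              - 2 * t2 / w1 * scalar_prod v (Ai *\<^sub>v c1)
              + t2\<^sup>2 / w1 \<and>
         \<gamma> (- 2 * int n)
            > scalar_prod z2 ((Bi + (1 / w2) \<cdot>\<^sub>m (Bi * outer c2 * Bi)) *\<^sub>v z2)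
              - 2 * \<gamma> (2 * int n) / w2 * scalar_prod z2 (Bi *\<^sub>v c2)
              + (\<gamma> (2 * int n))\<^sup>2 / w2)"
  shows "\<exists>\<mu>. representing_measure (zero_set (curve_poly q)) n \<beta> \<mu>"
proof -
  have n: "n \<ge> 1" using assms(3) by simp
  obtain t1 t2 t3 where "hankel_pos (gamma q \<beta> n t1 t2 t3) (- 2 * int n) (Suc (4 * n))"
    using assms(7) hankel_pos_gamma[OF n assms(6)] unfolding Let_def greaterThanLessThan_iff by blast
  then have pos: "positive_functional (\<lambda>k. gamma q \<beta> n t1 t2 t3 (- 2 * int n + int k)) (4 * n)"
    by (intro hankel_pos_imp_positive_functional)
  have "4 * n > 0" using n by simp
  then obtain S w where S: "finite S" "0 \<notin> S" and w: "\<And>r. r \<in> S \<Longrightarrow> w r > 0"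
    and quad: "\<And>k. k \<le> 2 * (4 * n) \<Longrightarrow>
      gamma q \<beta> n t1 t2 t3 (- 2 * int n + int k) = (\<Sum>r\<in>S. w r * r ^ k)"
    using gauss_quadrature_nonzero_nodes[OF pos] by blast
  \<comment> \<open>The quadrature represents the sequence shifted by 2n. Undoing the shift
    multiplies each weight by r^(2n), which stays positive as the exponent is even, and needs
    nonzero nodes for the negative powers.\<close>
  have \<gamma>: "gamma q \<beta> n t1 t2 t3 k = (\<Sum>r\<in>S. (w r * r ^ (2 * n)) * r powi k)"
    if "- 2 * int n \<le> k" "k \<le> 6 * int n" for k
  proof -
    have "gamma q \<beta> n t1 t2 t3 k = (\<Sum>r\<in>S. w r * r ^ nat (k + 2 * int n))"
      using quad[of "nat (k + 2 * int n)"] that by simp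
    also have "\<dots> = (\<Sum>r\<in>S. (w r * r ^ (2 * n)) * r powi k)"
    proof (intro sum.cong refl)
      fix r assume "r \<in> S"
      then have "r \<noteq> 0" using S by auto
      have "r ^ nat (k + 2 * int n) = r powi (int (2 * n) + k)"
        using that by (simp add: power_int_def add.commute)
      also have "\<dots> = r ^ (2 * n) * r powi k"
        using \<open>r \<noteq> 0\<close> by (subst power_int_add) (simp, simp only: power_int_of_nat)
      finally show "w r * r ^ nat (k + 2 * int n) = w r * r ^ (2 * n) * r powi k" by simp
    qed
    finally show ?thesis .
  qed
  show ?thesis
  proof (rule atomic_representing_measure[OF S(1) closed_zero_set_curve_poly])
    show "(\<lambda>r. (r, branch q r)) ` S \<subseteq> zero_set (curve_poly q)"
    proof (rule image_subsetI)
      fix r assume "r \<in> S"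
      then have "r \<noteq> 0" using S(2) by auto
      then show "(r, branch q r) \<in> zero_set (curve_poly q)"
        by (simp add: zero_set_curve_poly branch_def)
    qed
    show "w r * r ^ (2 * n) \<ge> 0" if "r \<in> S" for r
      using w[OF that] by (simp add: zero_le_even_power)
    show "\<beta> i j = (\<Sum>r\<in>S. w r * r ^ (2 * n) *
        (fst (r, branch q r) ^ i * snd (r, branch q r) ^ j))" if "i + j \<le> 2 * n" for i j
      unfolding fst_conv snd_conv by (rule moments_on_curve[OF assms(1-4) S(2) \<gamma> that])
  qed
qed

end
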